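(* Let $n>0$ be an integer, and $\psi\in(0,1)$ a parameter. The graph $G$ over $[n]$ constructed as described in the context has $O\bigl((n/\psi^{4/3})\log n\bigr)$ edges. Furthermore, for a graph $H\sim\mathcal D(G,\psi)$, $H$ provides a straight path with at most $4$ hops for all pairs $i<j$ in $[n]$ except (in expectation) at most $n/\psi^2+1$ pairs. For all pairs $i,j$ with $j>i+\Omega(\psi^{-4/3}\log n)$, such a $4$-hop straight path exists in $H$ with high probability.
   Context: $[n]=\{1,\dots,n\}$. For a graph $G$ with vertex set $[n]$ and $i<j$, a straight path from $i$ to $j$ in $G$ is a path $i=i_1<i_2<\dots<i_m=j$ all of whose consecutive pairs are edges of $G$; its number of hops is its number of edges. $\mathcal D(G,\psi)$ is the distribution of the random subgraph of $G$ (same vertex set) in which each edge of $G$ is kept independently with probability $\psi$. "With high probability" means with probability at least $1-1/n^{O(1)}$. Construction of $G$ (a random graph). Let $c$ be a sufficiently large constant, and set $\nabla=1/\psi^{1/3}$, $b=\bigl\lceil\frac{c\nabla}{\psi}\ln n\bigr\rceil=\bigl\lceil\frac{c}{\psi^{4/3}}\ln n\bigr\rceil$, $L=6b$ and $\tau=\frac{c^2\nabla}{\psi b}$. (1) Connect every two vertices $i<j$ of $[n]$ with $|i-j|\le L$. (2) Partition $[n]$ into consecutive blocks $B_1,\dots,B_{n/b}$ of size $b$, with $B_i=\{(i-1)b+1,\dots,ib\}$. Build the following graph whose vertices are the blocks, in their natural order: connect the median block to all the other blocks, and continue recursively on the blocks before the median and on the blocks after the median (so any two blocks are joined by a monotone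 path with at most 2 edges). Replace every edge $B_iB_j$ of this block graph by a random bipartite connector, that is, a random graph obtained by picking each edge of the complete bipartite graph between $B_i$ and $B_j$ independently with probability $\tau$. $G$ is the union of the edges from (1) and (2). *)

theory Defs
  imports "HOL-Probability.Probability" "HOL-Probability.Product_PMF"
begin

text \<open>
  All graphs live on sets of natural numbers and are given by their edge sets; the undirected edge
  joining u and v with \<open>u < v\<close> is represented by the pair (u, v).  With this convention
  \<open>A \<times> B\<close> is the complete bipartite graph between A and B whenever A lies entirely before B.
\<close>

type_synonym graph = "(nat \<times> nat) set"

definition straight_path :: "graph \<Rightarrow> nat \<Rightarrow> nat \<Rightarrow> nat list \<Rightarrow> bool" where
  "straight_path E i j p \<longleftrightarrow>
     p \<noteq> [] \<and> hd p = i \<and> last p = j \<and> sorted_wrt (<) p \<and> successively (\<lambda>u v. (u, v) \<in> E) p"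

definition hops :: "nat list \<Rightarrow> nat" where
  "hops p = length p - 1"

definition has_straight_path :: "graph \<Rightarrow> nat \<Rightarrow> nat \<Rightarrow> nat \<Rightarrow> bool" where
  "has_straight_path E h i j \<longleftrightarrow> (\<exists>p. straight_path E i j p \<and> hops p \<le> h)"

definition uncovered_pairs :: "nat \<Rightarrow> graph \<Rightarrow> nat \<Rightarrow> (nat \<times> nat) set" where
  "uncovered_pairs n E h = {(i, j). 1 \<le> i \<and> i < j \<and> j \<le> n \<and> \<not> has_straight_path E h i j}"

text \<open>The distribution D(E, p): every edge of the (finite) graph E is kept independently with
  probability p.\<close>

definition random_subgraph :: "graph \<Rightarrow> real \<Rightarrow> graph pmf" where
  "random_subgraph E p = map_pmf (\<lambda>f. {e \<in> E. f e}) (Pi_pmf E False (\<lambda>_. bernoulli_pmf p))"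

definition nabla :: "real \<Rightarrow> real" where
  "nabla \<psi> = 1 / \<psi> powr (1 / 3)"

definition block_size :: "real \<Rightarrow> nat \<Rightarrow> real \<Rightarrow> nat" where
  "block_size c n \<psi> = nat \<lceil>c * nabla \<psi> / \<psi> * ln (real n)\<rceil>"

definition reach :: "real \<Rightarrow> nat \<Rightarrow> real \<Rightarrow> nat" where
  "reach c n \<psi> = 6 * block_size c n \<psi>"

text \<open>The truncation at 1 only matters when n is bounded in terms of c, as the
  untruncated value is at most \<open>c / ln n\<close>.\<close>

definition tau :: "real \<Rightarrow> nat \<Rightarrow> real \<Rightarrow> real" where
  "tau c n \<psi> = min 1 (c\<^sup>2 * nabla \<psi> / (\<psi> * real (block_size c n \<psi>)))"

text \<open>If the block size b does not divide n, the number of blocks is rounded up and the last block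
  is cut off at n.  For \<open>n = 1\<close> we have \<open>b = 0\<close> and hence (as \<open>x / 0 = 0\<close>) no blocks; the graph
  constructed below then has no edges.\<close>

definition num_blocks :: "nat \<Rightarrow> nat \<Rightarrow> nat" where
  "num_blocks n b = nat \<lceil>real n / real b\<rceil>"

definition block :: "nat \<Rightarrow> nat \<Rightarrow> nat \<Rightarrow> nat set" where
  "block n b i = {(i - 1) * b + 1 .. i * b} \<inter> {1..n}"

text \<open>The block graph on the block indices \<open>lo, \<dots>, hi - 1\<close>.  For an even number of blocks the
  upper one of the two middle blocks serves as the median.\<close>

function block_graph :: "nat \<Rightarrow> nat \<Rightarrow> graph" where
  "block_graph lo hi =
     (if hi \<le> lo then {}
      else let m = (lo + hi) div 2 in
        (\<lambda>k. (k, m)) ` {lo..<m} \<union> (\<lambda>k. (m, k)) ` {m<..<hi} \<union>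
        block_graph lo m \<union> block_graph (m + 1) hi)"
  by pat_completeness auto
termination
  by (relation "Wellfounded.measure (\<lambda>(lo, hi). hi - lo)") auto

declare block_graph.simps [simp del]

definition local_edges :: "nat \<Rightarrow> nat \<Rightarrow> graph" where
  "local_edges n L = {(i, j). 1 \<le> i \<and> i < j \<and> j \<le> n \<and> j - i \<le> L}"

text \<open>The distribution of G.  The connectors of distinct edges of the block graph are drawn
  independently.\<close>

definition random_G :: "real \<Rightarrow> nat \<Rightarrow> real \<Rightarrow> graph pmf" where
  "random_G c n \<psi> =
     (let b = block_size c n \<psi>; BG = block_graph 1 (num_blocks n b + 1)
      in map_pmf (\<lambda>conn. local_edges n (reach c n \<psi>) \<union> (\<Union>e\<in>BG. conn e))
           (Pi_pmf BG {} (\<lambda>(I, J). random_subgraph (block n b I \<times> block n b J) (tau c n \<psi>))))"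

text \<open>The distribution of H drawn from D(G, \<open>\<psi>\<close>), with G itself random.\<close>

definition random_H :: "real \<Rightarrow> nat \<Rightarrow> real \<Rightarrow> graph pmf" where
  "random_H c n \<psi> = bind_pmf (random_G c n \<psi>) (\<lambda>G. random_subgraph G \<psi>)"

end

theory Submission
  imports Defs
begin

text \<open>
  H has independent edges: those of length at most L survive with probability \<open>\<psi>\<close>, the other
  connector edges with probability \<open>\<tau> \<psi>\<close>.  A pair at distance \<open>d \<le> L\<close> is missed with
  probability at most \<open>(1 - \<psi>\<^sup>2)\<close> to the power \<open>d - 1\<close>, by looking at two-hop paths only, and
  these probabilities sum to at most \<open>1 / \<psi>\<^sup>2\<close> per left endpoint.

  For \<open>j - i > L = 6 b\<close> there are full blocks A, M, D strictly between the blocks of i and j with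
  A and D within distance L of i and j, and connectors A-M and M-D.  With high probability i and j
  have at least \<open>b \<psi> / 4\<close> neighbours in A and D; given that, each vertex of M is joined to both
  neighbourhoods with probability at least \<open>\<psi> powr (4 / 3) / 4\<close>, independently over M.  Since b is
  at least \<open>c ln n / \<psi> powr (4 / 3)\<close>, the pair is missed with probability at most
  \<open>3 / n powr (c / 4)\<close>, and a union bound over all pairs applies once \<open>c \<ge> 16 + 4 C\<close>.
\<close>

subsection \<open>Random sets with independent elements\<close>

text \<open>Generalises \<open>random_subgraph\<close> to element-dependent probabilities, because
  local edges and pure connector edges survive in H with different probabilities.\<close>

definition random_set :: "'a set \<Rightarrow> ('a \<Rightarrow> real) \<Rightarrow> 'a set pmf" where
  "random_set E p = map_pmf (\<lambda>f. {e \<in> E. f e}) (Pi_pmf E False (\<lambda>e. bernoulli_pmf (p e)))"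

lemma random_subgraph_eq_random_set: "random_subgraph E p = random_set E (\<lambda>_. p)"
  by (simp add: random_subgraph_def random_set_def)

lemma random_set_empty [simp]: "random_set {} p = return_pmf {}"
  by (simp add: random_set_def)

lemma random_set_cong:
  assumes "A = B" "\<And>e. e \<in> B \<Longrightarrow> p e = q e"
  shows "random_set A p = random_set B q"
  unfolding random_set_def using assms by (auto intro!: map_pmf_cong Pi_pmf_cong)

lemma set_pmf_random_set_subset: "set_pmf (random_set E p) \<subseteq> Pow E"
  by (auto simp: random_set_def)

lemma finite_set_pmf_random_set: "finite E \<Longrightarrow> finite (set_pmf (random_set E p))"
  by (rule finite_subset[OF set_pmf_random_set_subset]) simp

lemma random_set_Un:
  assumes "finite A" "finite B" "A \<inter> B = {}"
  shows "random_set (A \<union> B) p =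
    map_pmf (\<lambda>(X, Y). X \<union> Y) (pair_pmf (random_set A p) (random_set B p))"
  unfolding random_set_def Pi_pmf_union[OF assms] map_pair[symmetric] pmf.map_comp
  by (rule map_pmf_cong) (use assms(3) in auto)

lemma random_set_Int:
  assumes "finite E" "A \<subseteq> E"
  shows "map_pmf (\<lambda>X. X \<inter> A) (random_set E p) = random_set A p"
  unfolding random_set_def Pi_pmf_subset[OF assms] pmf.map_comp
  by (rule map_pmf_cong) (use assms in auto)

lemma random_set_one: "finite E \<Longrightarrow> random_set E (\<lambda>_. 1) = return_pmf E"
proof -
  assume "finite E"
  moreover have "bernoulli_pmf 1 = return_pmf True"
    by (rule pmf_eqI) (auto simp: indicator_def split: bool.splits)
  ultimately show ?thesis
    by (auto simp: random_set_def)
qed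

text \<open>Merges independent draws on disjoint ground sets into one draw. This turns the
  independently drawn connectors into a single random edge set.\<close>

lemma random_set_UNION:
  assumes "finite I" "\<And>i. i \<in> I \<Longrightarrow> finite (K i)" "disjoint_family_on K I"
  shows "map_pmf (\<lambda>X. \<Union>i\<in>I. X i) (Pi_pmf I {} (\<lambda>i. random_set (K i) p)) = random_set (\<Union>i\<in>I. K i) p"
  using assms
proof (induction I rule: finite_induct)
  case (insert x F)
  have IH: "map_pmf (\<lambda>X. \<Union>i\<in>F. X i) (Pi_pmf F {} (\<lambda>i. random_set (K i) p)) =
      random_set (\<Union>i\<in>F. K i) p"
    using insert by (intro insert.IH) (auto simp: disjoint_family_on_def)
  have "K x \<inter> K i = {}" if "i \<in> F" for i
    using insert.prems(2) insert.hyps(2) that by (auto dest!: disjoint_family_onD[of K _ x i])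
  then have "K x \<inter> (\<Union>i\<in>F. K i) = {}"
    by auto
  moreover have "(\<Union>i\<in>F. (f(x := y)) i) = (\<Union>i\<in>F. f i)" for f :: "'a \<Rightarrow> 'b set" and y
    using insert.hyps by auto
  ultimately show ?case
    using insert.prems insert.hyps
    by (simp add: random_set_Un Pi_pmf_insert pmf.map_comp o_def case_prod_unfold
        pair_map_pmf2 flip: IH del: fun_upd_apply) (simp add: Un_commute)
qed simp

text \<open>An element survives both rounds iff two independent coins succeed, independently over
  the elements. Hence sampling G and then H from G collapses into one product distribution.\<close>

lemma random_set_thin:
  assumes "finite E" "\<And>e. e \<in> E \<Longrightarrow> 0 \<le> p e \<and> p e \<le> 1" "\<And>e. e \<in> E \<Longrightarrow> 0 \<le> q e \<and> q e \<le> 1"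
  shows "random_set E p \<bind> (\<lambda>X. random_set X q) = random_set E (\<lambda>e. p e * q e)"
proof -
  \<comment> \<open>The second coin is tossed only if the first one succeeds. In this form the first
    coins can be pulled out of the product, which leaves second coins only on the survivors.\<close>
  have bern: "bernoulli_pmf (p e * q e) =
      bernoulli_pmf (p e) \<bind> (\<lambda>b. if b then bernoulli_pmf (q e) else return_pmf False)"
    if "e \<in> E" for e
  proof (rule pmf_eqI)
    fix x
    have "0 \<le> p e * q e" "p e * q e \<le> 1"
      using assms(2,3)[OF that] by (auto intro: mult_le_one)
    then show "pmf (bernoulli_pmf (p e * q e)) x =
      pmf (bernoulli_pmf (p e) \<bind> (\<lambda>b. if b then bernoulli_pmf (q e) else return_pmf False)) x"
      using assms(2,3)[OF that] by (cases x) (auto simp: pmf_bind algebra_simps)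
  qed
  have "Pi_pmf E False (\<lambda>e. bernoulli_pmf (p e * q e)) =
      Pi_pmf E False (\<lambda>e. bernoulli_pmf (p e) \<bind>
        (\<lambda>b. if b then bernoulli_pmf (q e) else return_pmf False))"
    by (rule Pi_pmf_cong) (auto simp: bern)
  also have "\<dots> = Pi_pmf E False (\<lambda>e. bernoulli_pmf (p e)) \<bind>
      (\<lambda>f. Pi_pmf {e \<in> E. f e} False (\<lambda>e. bernoulli_pmf (q e)))"
    using assms(1) by (subst Pi_pmf_bind[where d' = False]) (auto simp: Pi_pmf_if_set)
  finally have "random_set E (\<lambda>e. p e * q e) = Pi_pmf E False (\<lambda>e. bernoulli_pmf (p e)) \<bind>
      (\<lambda>f. map_pmf (\<lambda>g. {e \<in> E. g e}) (Pi_pmf {e \<in> E. f e} False (\<lambda>e. bernoulli_pmf (q e))))"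
    unfolding random_set_def by (simp add: map_bind_pmf)
  also have "\<dots> = Pi_pmf E False (\<lambda>e. bernoulli_pmf (p e)) \<bind> (\<lambda>f. random_set {e \<in> E. f e} q)"
  proof (rule bind_pmf_cong[OF refl])
    fix f
    have "map_pmf (\<lambda>g. {e \<in> E. g e}) (Pi_pmf {e \<in> E. f e} False (\<lambda>e. bernoulli_pmf (q e))) =
        map_pmf (\<lambda>g. {e \<in> {e \<in> E. f e}. g e})
          (Pi_pmf {e \<in> E. f e} False (\<lambda>e. bernoulli_pmf (q e)))"
    \<comment> \<open>Outside its index set a function drawn from \<open>Pi_pmf\<close> has the
      default value \<open>False\<close>, so both comprehensions agree on the support.\<close>
    proof (rule map_pmf_cong[OF refl])
      fix g assume "g \<in> set_pmf (Pi_pmf {e \<in> E. f e} False (\<lambda>e. bernoulli_pmf (q e)))"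
      then show "{e \<in> E. g e} = {e \<in> {e \<in> E. f e}. g e}"
        using set_Pi_pmf_subset[of "{e \<in> E. f e}" False "\<lambda>e. bernoulli_pmf (q e)"] assms(1) by auto
    qed
    then show "map_pmf (\<lambda>g. {e \<in> E. g e}) (Pi_pmf {e \<in> E. f e} False (\<lambda>e. bernoulli_pmf (q e))) =
        random_set {e \<in> E. f e} q"
      by (simp add: random_set_def)
  qed
  also have "\<dots> = random_set E p \<bind> (\<lambda>X. random_set X q)"
    by (simp add: random_set_def bind_map_pmf)
  finally show ?thesis ..
qed

section \<open>Two-stage exposure and independence\<close>

lemma prob_bind_le:
  assumes "\<And>x. x \<in> set_pmf M \<Longrightarrow> x \<notin> B \<Longrightarrow> measure_pmf.prob (N x) A \<le> \<epsilon>" "0 \<le> \<epsilon>"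
  shows "measure_pmf.prob (M \<bind> N) A \<le> measure_pmf.prob M B + \<epsilon>"
proof -
  have "emeasure (measure_pmf (M \<bind> N)) A = (\<integral>\<^sup>+x. emeasure (N x) A \<partial>M)"
    by simp
  also have "\<dots> \<le> (\<integral>\<^sup>+x. indicator B x + ennreal \<epsilon> \<partial>M)"
  proof (rule nn_integral_mono_AE, rule AE_pmfI)
    fix x assume "x \<in> set_pmf M"
    then show "emeasure (N x) A \<le> indicator B x + ennreal \<epsilon>"
      using assms(1)[of x] by (auto simp: indicator_def measure_pmf.emeasure_eq_measure
          intro!: ennreal_leI add_increasing2)
  qed
  also have "\<dots> = ennreal (measure_pmf.prob M B + \<epsilon>)"
    using assms(2) by (simp add: nn_integral_add measure_pmf.emeasure_eq_measure)
  finally show ?thesis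
    using assms(2) by (simp add: measure_pmf.emeasure_eq_measure flip: ennreal_plus)
qed

text \<open>Exposes \<open>E\<^sub>1\<close> first and \<open>E\<^sub>2\<close> afterwards.
  Disjointness makes the second stage independent of the outcome \<open>Y\<close> of the first, so
  \<open>le\<close> may treat \<open>Y\<close> as fixed; outcomes in \<open>B\<close> are charged in
  full.\<close>

lemma prob_random_set_two_stage:
  assumes "finite E" "E\<^sub>1 \<subseteq> E" "E\<^sub>2 \<subseteq> E" "E\<^sub>1 \<inter> E\<^sub>2 = {}" "0 \<le> \<epsilon>"
    and le: "\<And>Y. Y \<subseteq> E\<^sub>1 \<Longrightarrow> Y \<notin> B \<Longrightarrow>
      measure_pmf.prob (random_set E p) {X. R Y (X \<inter> E\<^sub>2)} \<le> \<epsilon>"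
  shows "measure_pmf.prob (random_set E p) {X. R (X \<inter> E\<^sub>1) (X \<inter> E\<^sub>2)} \<le>
    measure_pmf.prob (random_set E p) {X. X \<inter> E\<^sub>1 \<in> B} + \<epsilon>"
proof -
  have fin: "finite E\<^sub>1" "finite E\<^sub>2"
    using assms(1-3) by (auto dest: finite_subset)
  \<comment> \<open>Events that depend on \<open>X \<inter> F\<close> only may be evaluated in the
    marginal distribution on \<open>F\<close>.\<close>
  have transfer: "measure_pmf.prob (random_set E p) {X. P (X \<inter> F)} =
      measure_pmf.prob (random_set F p) {X. P X}" if "F \<subseteq> E" for F P
    by (simp add: random_set_Int[OF assms(1) that, symmetric] vimage_def)
  have "measure_pmf.prob (random_set E p) {X. R (X \<inter> E\<^sub>1) (X \<inter> E\<^sub>2)} =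
      measure_pmf.prob (random_set (E\<^sub>1 \<union> E\<^sub>2) p) {X. R (X \<inter> E\<^sub>1) (X \<inter> E\<^sub>2)}"
    using transfer[of "E\<^sub>1 \<union> E\<^sub>2" "\<lambda>X. R (X \<inter> E\<^sub>1) (X \<inter> E\<^sub>2)"] assms(2,3)
    by (simp add: Int_assoc Int_absorb1 inf_sup_absorb Int_absorb2)
  also have "random_set (E\<^sub>1 \<union> E\<^sub>2) p =
      random_set E\<^sub>1 p \<bind> (\<lambda>Y. map_pmf (\<lambda>Z. Y \<union> Z) (random_set E\<^sub>2 p))"
    unfolding random_set_Un[OF fin assms(4)]
    by (simp add: pair_pmf_def map_bind_pmf bind_return_pmf map_pmf_def bind_assoc_pmf)
  also have "measure_pmf.prob \<dots> {X. R (X \<inter> E\<^sub>1) (X \<inter> E\<^sub>2)} \<le>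
      measure_pmf.prob (random_set E\<^sub>1 p) B + \<epsilon>"
  proof (rule prob_bind_le)
    fix Y assume "Y \<in> set_pmf (random_set E\<^sub>1 p)" "Y \<notin> B"
    then have Y: "Y \<subseteq> E\<^sub>1" "Y \<notin> B"
      using set_pmf_random_set_subset[of E\<^sub>1 p] by auto
    have "measure_pmf.prob (map_pmf (\<lambda>Z. Y \<union> Z) (random_set E\<^sub>2 p)) {X. R (X \<inter> E\<^sub>1) (X \<inter> E\<^sub>2)} =
        measure_pmf.prob (random_set E\<^sub>2 p) {Z. R ((Y \<union> Z) \<inter> E\<^sub>1) ((Y \<union> Z) \<inter> E\<^sub>2)}"
      by (simp add: vimage_def)
    also have "\<dots> = measure_pmf.prob (random_set E\<^sub>2 p) {Z. R Y Z}"
    proof (rule measure_pmf.finite_measure_eq_AE)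
      show "AE Z in random_set E\<^sub>2 p. (Z \<in> {Z. R ((Y \<union> Z) \<inter> E\<^sub>1) ((Y \<union> Z) \<inter> E\<^sub>2)}) = (Z \<in> {Z. R Y Z})"
      proof (rule AE_pmfI)
        fix Z assume "Z \<in> set_pmf (random_set E\<^sub>2 p)"
        then have "Z \<subseteq> E\<^sub>2"
          using set_pmf_random_set_subset[of E\<^sub>2 p] by auto
        then have "(Y \<union> Z) \<inter> E\<^sub>1 = Y" "(Y \<union> Z) \<inter> E\<^sub>2 = Z"
          using Y assms(4) by auto
        then show "(Z \<in> {Z. R ((Y \<union> Z) \<inter> E\<^sub>1) ((Y \<union> Z) \<inter> E\<^sub>2)}) = (Z \<in> {Z. R Y Z})"
          by simp
      qed
    qed auto
    also have "\<dots> \<le> \<epsilon>"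
      using le[OF Y] transfer[OF assms(3)] by simp
    finally show "measure_pmf.prob (map_pmf (\<lambda>Z. Y \<union> Z) (random_set E\<^sub>2 p))
      {X. R (X \<inter> E\<^sub>1) (X \<inter> E\<^sub>2)} \<le> \<epsilon>" .
  qed fact
  finally show ?thesis
    using transfer[OF assms(2), of "\<lambda>X. X \<in> B"] by simp
qed

lemma prob_random_set_indep2:
  assumes "finite E" "K\<^sub>1 \<subseteq> E" "K\<^sub>2 \<subseteq> E" "K\<^sub>1 \<inter> K\<^sub>2 = {}"
  shows "measure_pmf.prob (random_set E p) {X. P (X \<inter> K\<^sub>1) \<and> Q (X \<inter> K\<^sub>2)} =
    measure_pmf.prob (random_set E p) {X. P (X \<inter> K\<^sub>1)} *
    measure_pmf.prob (random_set E p) {X. Q (X \<inter> K\<^sub>2)}"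
proof -
  have fin: "finite K\<^sub>1" "finite K\<^sub>2"
    using assms(1-3) by (auto dest: finite_subset)
  have transfer: "measure_pmf.prob (random_set E p) {X. P (X \<inter> F)} =
      measure_pmf.prob (random_set F p) {X. P X}" if "F \<subseteq> E" for F P
    by (simp add: random_set_Int[OF assms(1) that, symmetric] vimage_def)
  have "measure_pmf.prob (random_set E p) {X. P (X \<inter> K\<^sub>1) \<and> Q (X \<inter> K\<^sub>2)} =
      measure_pmf.prob (random_set (K\<^sub>1 \<union> K\<^sub>2) p) {X. P (X \<inter> K\<^sub>1) \<and> Q (X \<inter> K\<^sub>2)}"
    using transfer[of "K\<^sub>1 \<union> K\<^sub>2" "\<lambda>X. P (X \<inter> K\<^sub>1) \<and> Q (X \<inter> K\<^sub>2)"] assms(2,3)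
    by (simp add: Int_assoc Int_absorb1 inf_sup_absorb Int_absorb2)
  also have "\<dots> = measure_pmf.prob (pair_pmf (random_set K\<^sub>1 p) (random_set K\<^sub>2 p))
      {(Y, Z). P ((Y \<union> Z) \<inter> K\<^sub>1) \<and> Q ((Y \<union> Z) \<inter> K\<^sub>2)}"
    unfolding random_set_Un[OF fin assms(4)] by (simp add: vimage_def case_prod_unfold)
  \<comment> \<open>On the support \<open>Y\<close> and \<open>Z\<close> stay within their own
    ground sets, so the event becomes a rectangle and the product measure factorises.\<close>
  also have "\<dots> = measure_pmf.prob (pair_pmf (random_set K\<^sub>1 p) (random_set K\<^sub>2 p))
      ({Y. Y \<subseteq> K\<^sub>1 \<and> P Y} \<times> {Z. Z \<subseteq> K\<^sub>2 \<and> Q Z})"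
  proof (rule measure_pmf.finite_measure_eq_AE)
    show "AE x in pair_pmf (random_set K\<^sub>1 p) (random_set K\<^sub>2 p).
      (x \<in> {(Y, Z). P ((Y \<union> Z) \<inter> K\<^sub>1) \<and> Q ((Y \<union> Z) \<inter> K\<^sub>2)}) =
      (x \<in> {Y. Y \<subseteq> K\<^sub>1 \<and> P Y} \<times> {Z. Z \<subseteq> K\<^sub>2 \<and> Q Z})"
    proof (rule AE_pmfI)
      fix x assume "x \<in> set_pmf (pair_pmf (random_set K\<^sub>1 p) (random_set K\<^sub>2 p))"
      then obtain Y Z where x: "x = (Y, Z)" "Y \<subseteq> K\<^sub>1" "Z \<subseteq> K\<^sub>2"
        using set_pmf_random_set_subset[of K\<^sub>1 p] set_pmf_random_set_subset[of K\<^sub>2 p]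
        by (cases x) auto
      then have "(Y \<union> Z) \<inter> K\<^sub>1 = Y" "(Y \<union> Z) \<inter> K\<^sub>2 = Z"
        using assms(4) by auto
      with x show "(x \<in> {(Y, Z). P ((Y \<union> Z) \<inter> K\<^sub>1) \<and> Q ((Y \<union> Z) \<inter> K\<^sub>2)}) =
          (x \<in> {Y. Y \<subseteq> K\<^sub>1 \<and> P Y} \<times> {Z. Z \<subseteq> K\<^sub>2 \<and> Q Z})"
        by simp
    qed
  qed auto
  also have "\<dots> = measure_pmf.prob (random_set K\<^sub>1 p) {Y. Y \<subseteq> K\<^sub>1 \<and> P Y} *
      measure_pmf.prob (random_set K\<^sub>2 p) {Z. Z \<subseteq> K\<^sub>2 \<and> Q Z}"
  proof (rule measure_pmf_prob_product)
    have "finite {Y. Y \<subseteq> K\<^sub>1 \<and> P Y}" "finite {Z. Z \<subseteq> K\<^sub>2 \<and> Q Z}"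
      using fin by (auto intro: finite_subset[OF _ finite_Pow_iff[THEN iffD2]])
    then show "countable {Y. Y \<subseteq> K\<^sub>1 \<and> P Y}" "countable {Z. Z \<subseteq> K\<^sub>2 \<and> Q Z}"
      by (auto intro: countable_finite)
  qed
  also have "measure_pmf.prob (random_set K\<^sub>1 p) {Y. Y \<subseteq> K\<^sub>1 \<and> P Y} =
      measure_pmf.prob (random_set E p) {X. P (X \<inter> K\<^sub>1)}"
    using transfer[OF assms(2), of "\<lambda>Y. Y \<subseteq> K\<^sub>1 \<and> P Y"] by simp
  also have "measure_pmf.prob (random_set K\<^sub>2 p) {Z. Z \<subseteq> K\<^sub>2 \<and> Q Z} =
      measure_pmf.prob (random_set E p) {X. Q (X \<inter> K\<^sub>2)}"
    using transfer[OF assms(3), of "\<lambda>Y. Y \<subseteq> K\<^sub>2 \<and> Q Y"] by simp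
  finally show ?thesis .
qed

lemma prob_random_set_indep:
  assumes "finite E" "finite I" "\<And>i. i \<in> I \<Longrightarrow> K i \<subseteq> E" "disjoint_family_on K I"
  shows "measure_pmf.prob (random_set E p) {X. \<forall>i\<in>I. Q i (X \<inter> K i)} =
    (\<Prod>i\<in>I. measure_pmf.prob (random_set E p) {X. Q i (X \<inter> K i)})"
  using assms(2-)
proof (induction I rule: finite_induct)
  case (insert x F)
  have "K x \<inter> K i = {}" if "i \<in> F" for i
    using insert.prems(2) insert.hyps(2) that by (auto dest!: disjoint_family_onD[of K _ x i])
  then have disj: "K x \<inter> (\<Union>i\<in>F. K i) = {}"
    by auto
  \<comment> \<open>Inserting the union makes the events for \<open>F\<close> visibly a function of
    \<open>X\<close> restricted to a single set disjoint from \<open>K x\<close>, as the two-set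
    case requires.\<close>
  have *: "X \<inter> (\<Union>i\<in>F. K i) \<inter> K i = X \<inter> K i" if "i \<in> F" for X i
    using that by auto
  have "measure_pmf.prob (random_set E p) {X. \<forall>i\<in>insert x F. Q i (X \<inter> K i)} =
     measure_pmf.prob (random_set E p) {X. Q x (X \<inter> K x) \<and>
       (\<forall>i\<in>F. Q i (X \<inter> (\<Union>i\<in>F. K i) \<inter> K i))}"
    by (simp add: * cong: ball_cong)
  also have "\<dots> = measure_pmf.prob (random_set E p) {X. Q x (X \<inter> K x)} *
      measure_pmf.prob (random_set E p) {X. \<forall>i\<in>F. Q i (X \<inter> (\<Union>i\<in>F. K i) \<inter> K i)}"
    using insert.prems disj
    by (intro prob_random_set_indep2[OF assms(1), where Q = "\<lambda>Y. \<forall>i\<in>F. Q i (Y \<inter> K i)"]) auto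
  also have "measure_pmf.prob (random_set E p) {X. \<forall>i\<in>F. Q i (X \<inter> (\<Union>i\<in>F. K i) \<inter> K i)} =
      (\<Prod>i\<in>F. measure_pmf.prob (random_set E p) {X. Q i (X \<inter> K i)})"
    using insert by (simp add: * disjoint_family_on_def cong: ball_cong)
  finally show ?case
    using insert.hyps by simp
qed simp

section \<open>Single elements, exponential moments and tail bounds\<close>

lemma prob_random_set_mem:
  assumes "finite E" "e \<in> E" "0 \<le> p e" "p e \<le> 1"
  shows "measure_pmf.prob (random_set E p) {X. e \<in> X} = p e"
proof -
  have "measure_pmf.prob (random_set E p) {X. e \<in> X} =
      measure_pmf.prob (map_pmf (\<lambda>f. f e) (Pi_pmf E False (\<lambda>e. bernoulli_pmf (p e)))) {True}"
    using assms(2) by (simp add: random_set_def vimage_def)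
  also have "\<dots> = p e"
    using assms by (simp add: Pi_pmf_component measure_pmf_single)
  finally show ?thesis .
qed

lemma prob_random_set_not_mem:
  assumes "finite E" "e \<in> E" "0 \<le> p e" "p e \<le> 1"
  shows "measure_pmf.prob (random_set E p) {X. e \<notin> X} = 1 - p e"
  using prob_random_set_mem[of E e p] assms
    measure_pmf.prob_compl[of "{X. e \<in> X}" "random_set E p"]
  by (simp add: set_diff_eq)

lemma prob_random_set_avoid:
  assumes "finite E" "K \<subseteq> E" "\<And>e. e \<in> K \<Longrightarrow> 0 \<le> p e \<and> p e \<le> 1"
  shows "measure_pmf.prob (random_set E p) {X. \<forall>e\<in>K. e \<notin> X} = (\<Prod>e\<in>K. 1 - p e)"
proof -
  have "measure_pmf.prob (random_set E p) {X. \<forall>e\<in>K. e \<notin> X \<inter> {e}} =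
      (\<Prod>e\<in>K. measure_pmf.prob (random_set E p) {X. e \<notin> X \<inter> {e}})"
    using assms by (intro prob_random_set_indep) (auto simp: disjoint_family_on_def dest: finite_subset)
  also have "\<dots> = (\<Prod>e\<in>K. 1 - p e)"
    using assms by (intro prod.cong) (auto simp: prob_random_set_not_mem)
  finally show ?thesis
    by simp
qed

text \<open>This is the probability generating function of the cardinality: the power is a product
  of one factor per element, and the factors are independent.\<close>

lemma expectation_random_set_power_card:
  fixes t :: real
  assumes "finite E" "\<And>e. e \<in> E \<Longrightarrow> 0 \<le> p e \<and> p e \<le> 1" "0 \<le> t"
  shows "measure_pmf.expectation (random_set E p) (\<lambda>X. t ^ card X) = (\<Prod>e\<in>E. 1 + p e * (t - 1))"
proof -
  have *: "t ^ card {e \<in> E. f e} = (\<Prod>e\<in>E. if f e then t else 1)" for f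
    using assms(1) by (simp add: prod.If_cases Int_def)
  have "measure_pmf.expectation (random_set E p) (\<lambda>X. t ^ card X) =
      measure_pmf.expectation (Pi_pmf E False (\<lambda>e. bernoulli_pmf (p e)))
        (\<lambda>f. \<Prod>e\<in>E. if f e then t else 1)"
    by (simp add: random_set_def *)
  also have "\<dots> = (\<Prod>e\<in>E. measure_pmf.expectation (bernoulli_pmf (p e)) (\<lambda>b. if b then t else 1))"
    using assms by (intro expectation_prod_Pi_pmf[where f = "\<lambda>_ b. if b then t else 1"])
      (auto intro!: integrable_measure_pmf_finite)
  also have "\<dots> = (\<Prod>e\<in>E. 1 + p e * (t - 1))"
    using assms(2) by (intro prod.cong) (auto simp: algebra_simps)
  finally show ?thesis .
qed

lemma prod_one_plus_le_exp:
  fixes x :: "'a \<Rightarrow> real"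
  assumes "\<And>e. e \<in> E \<Longrightarrow> -1 \<le> x e"
  shows "(\<Prod>e\<in>E. 1 + x e) \<le> exp (\<Sum>e\<in>E. x e)"
proof (cases "finite E")
  case True
  have "(\<Prod>e\<in>E. 1 + x e) \<le> (\<Prod>e\<in>E. exp (x e))"
    using assms by (intro prod_mono) (force simp: add.commute)
  then show ?thesis
    using True by (simp add: exp_sum)
qed simp

lemma Markov_pmf:
  assumes "finite (set_pmf M)" "\<And>x. x \<in> set_pmf M \<Longrightarrow> 0 \<le> f x" "\<And>x. x \<in> A \<Longrightarrow> a \<le> f x" "(a::real) > 0"
  shows "measure_pmf.prob M A \<le> measure_pmf.expectation M f / a"
proof -
  have "measure_pmf.prob M A \<le> measure_pmf.prob M {x \<in> space M. a \<le> f x}"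
    using assms(3) by (intro measure_pmf.finite_measure_mono) auto
  also have "\<dots> \<le> measure_pmf.expectation M f / a"
    using assms by (intro integral_Markov_inequality_measure[where A = "{}"])
      (auto intro!: integrable_measure_pmf_finite AE_pmfI)
  finally show ?thesis .
qed

text \<open>Markov's inequality for \<open>exp 1 ^ card X\<close>. The factor 2 in front of the mean
  comes from \<open>exp 1 - 1 \<le> 2\<close>.\<close>

lemma Chernoff_upper:
  fixes k :: real
  assumes "finite E" "\<And>e. e \<in> E \<Longrightarrow> 0 \<le> p e \<and> p e \<le> 1"
  shows "measure_pmf.prob (random_set E p) {X. k \<le> card X} \<le> exp (2 * (\<Sum>e\<in>E. p e) - k)"
proof -
  have "measure_pmf.prob (random_set E p) {X. k \<le> card X} \<le>
      measure_pmf.expectation (random_set E p) (\<lambda>X. exp 1 ^ card X) / exp k"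
    using assms(1) by (intro Markov_pmf) (auto simp: finite_set_pmf_random_set simp flip: exp_of_nat_mult)
  also have "measure_pmf.expectation (random_set E p) (\<lambda>X. exp 1 ^ card X) =
      (\<Prod>e\<in>E. 1 + p e * (exp 1 - 1))"
    using assms by (intro expectation_random_set_power_card) auto
  also have "\<dots> \<le> (\<Prod>e\<in>E. 1 + p e * 2)"
  proof (rule prod_mono)
    fix e assume "e \<in> E"
    then have "0 \<le> p e" using assms by auto
    moreover have "1 \<le> exp (1::real)" by simp
    moreover have "exp (1::real) \<le> 3" by (rule exp_le)
    ultimately show "0 \<le> 1 + p e * (exp 1 - 1) \<and> 1 + p e * (exp 1 - 1) \<le> 1 + p e * 2"
      by (intro conjI add_left_mono mult_left_mono add_nonneg_nonneg mult_nonneg_nonneg) auto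
  qed
  also have "\<dots> \<le> exp (\<Sum>e\<in>E. p e * 2)"
    using assms(2) by (intro prod_one_plus_le_exp) fastforce
  also have "(\<Sum>e\<in>E. p e * 2) = 2 * (\<Sum>e\<in>E. p e)"
    by (simp add: mult.commute flip: sum_distrib_right)
  finally show ?thesis
    by (simp add: exp_diff divide_right_mono)
qed

text \<open>Markov's inequality for \<open>(1/2) ^ card X\<close>. With \<open>s\<close> a quarter
  of the mean, the expectation is at most \<open>exp (- (2 * s))\<close>; the event
  \<open>card X \<le> s\<close> forces the value up to \<open>exp (- s)\<close>, and the quotient is
  \<open>exp (- s)\<close>.\<close>

lemma Chernoff_lower:
  fixes q :: real
  assumes "finite E" "K \<subseteq> E" "\<And>e. e \<in> K \<Longrightarrow> p e = q" "0 \<le> q" "q \<le> 1"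
  shows "measure_pmf.prob (random_set E p) {X. card (X \<inter> K) \<le> card K * q / 4} \<le> exp (- (card K * q / 4))"
proof -
  define s where "s = card K * q / 4"
  have K: "finite K" using assms(1,2) by (rule finite_subset[rotated])
  have "measure_pmf.prob (random_set E p) {X. card (X \<inter> K) \<le> s} =
      measure_pmf.prob (random_set K p) {X. card X \<le> s}"
    by (simp add: random_set_Int[OF assms(1,2), symmetric] vimage_def)
  also have "\<dots> \<le> measure_pmf.expectation (random_set K p) (\<lambda>X. (1/2) ^ card X) / exp (- s)"
  proof (rule Markov_pmf)
    fix X assume "X \<in> {X. real (card X) \<le> s}"
    then have X: "card X \<le> s" by simp
    have "exp (- s) \<le> exp (- real (card X))" using X by simp
    also have "\<dots> = exp (- 1) ^ card X" by (simp flip: exp_of_nat_mult)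
    also have "\<dots> \<le> (1/2) ^ card X"
    proof (rule power_mono)
      have "2 \<le> exp (1::real)" using exp_ge_add_one_self[of 1] by simp
      then show "exp (-1) \<le> (1/2::real)" by (simp add: exp_minus field_simps)
    qed simp
    finally show "exp (- s) \<le> (1/2) ^ card X" .
  qed (use K in \<open>auto simp: finite_set_pmf_random_set\<close>)
  also have "measure_pmf.expectation (random_set K p) (\<lambda>X. (1/2) ^ card X) =
      (\<Prod>e\<in>K. 1 + p e * (1/2 - 1))"
    using K assms by (intro expectation_random_set_power_card) auto
  also have "\<dots> \<le> exp (\<Sum>e\<in>K. p e * (1/2 - 1))"
    using assms by (intro prod_one_plus_le_exp) auto
  also have "(\<Sum>e\<in>K. p e * (1/2 - 1)) = - (2 * s)"
    using assms(3) by (simp add: s_def)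
  finally show ?thesis
    by (simp add: exp_diff[symmetric] divide_right_mono s_def[symmetric])
qed

subsection \<open>Two-hop paths in the block graph\<close>

lemma block_graph_empty: "hi \<le> lo \<Longrightarrow> block_graph lo hi = {}"
  by (subst block_graph.simps) simp

lemma block_graph_bounds: "(x, y) \<in> block_graph lo hi \<Longrightarrow> lo \<le> x \<and> x < y \<and> y < hi"
proof (induction lo hi arbitrary: x y rule: block_graph.induct)
  case (1 lo hi)
  show ?case
  proof (cases "hi \<le> lo")
    case False
    define m where "m = (lo + hi) div 2"
    have m: "lo \<le> m" "m < hi"
      using False by (auto simp: m_def)
    have "(x, y) \<in> (\<lambda>k. (k, m)) ` {lo..<m} \<union> (\<lambda>k. (m, k)) ` {m<..<hi} \<union>
        block_graph lo m \<union> block_graph (m + 1) hi"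
      using 1(3) False by (subst (asm) block_graph.simps) (simp add: m_def Let_def)
    then consider "(x, y) \<in> (\<lambda>k. (k, m)) ` {lo..<m}" | "(x, y) \<in> (\<lambda>k. (m, k)) ` {m<..<hi}"
      | "(x, y) \<in> block_graph lo m" | "(x, y) \<in> block_graph (m + 1) hi"
      by blast
    then show ?thesis
      using m 1(1)[OF False m_def, of x y] 1(2)[OF False m_def, of x y] by cases auto
  qed (use 1(3) in \<open>simp add: block_graph_empty\<close>)
qed

lemma finite_block_graph: "finite (block_graph lo hi)"
  by (rule finite_subset[of _ "{lo..<hi} \<times> {lo..<hi}"]) (auto dest: block_graph_bounds)

lemma block_graph_left: "lo \<le> k \<Longrightarrow> k < (lo + hi) div 2 \<Longrightarrow> (k, (lo + hi) div 2) \<in> block_graph lo hi"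
  by (subst block_graph.simps) (auto simp: Let_def)

lemma block_graph_right: "(lo + hi) div 2 < k \<Longrightarrow> k < hi \<Longrightarrow> ((lo + hi) div 2, k) \<in> block_graph lo hi"
  by (subst block_graph.simps) (auto simp: Let_def)

lemma block_graph_lower: "lo < hi \<Longrightarrow> block_graph lo ((lo + hi) div 2) \<subseteq> block_graph lo hi"
  by (subst (2) block_graph.simps) (auto simp: Let_def)

lemma block_graph_upper: "lo < hi \<Longrightarrow> block_graph ((lo + hi) div 2 + 1) hi \<subseteq> block_graph lo hi"
  by (subst (2) block_graph.simps) (auto simp: Let_def)

text \<open>Each call on \<open>s\<close> blocks adds \<open>s - 1\<close> edges at its median and
  recurses on two ranges of at most half the length.\<close>

lemma card_block_graph: "real (card (block_graph lo hi)) \<le> real (hi - lo) * log 2 (real (hi - lo))"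
proof (induction lo hi rule: block_graph.induct)
  case (1 lo hi)
  show ?case
  proof (cases "hi \<le> lo")
    case True
    then show ?thesis by (simp add: block_graph_empty)
  next
    case False
    define m where "m = (lo + hi) div 2"
    define s where "s = hi - lo"
    have s: "s \<ge> 1" "(m - lo) + (hi - (m + 1)) = s - 1" "m - lo \<le> s div 2" "hi - (m + 1) \<le> s div 2"
      "(m - lo) + (hi - (m + 1)) = card {lo..<m} + card {m<..<hi}"
      using False unfolding m_def s_def by auto
    have half: "real k * log 2 (real k) \<le> real k * (log 2 (real s) - 1)" if "k \<le> s div 2" for k
    proof (cases "k = 0")
      case False
      have "log 2 (real k) \<le> log 2 (real s / 2)"
        using that False by (subst log_le_cancel_iff) auto
      also have "\<dots> = log 2 (real s) - 1"
        using s by (subst log_divide) auto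
      finally show ?thesis
        by (rule mult_left_mono) simp
    qed simp
    have "block_graph lo hi = (\<lambda>k. (k, m)) ` {lo..<m} \<union> (\<lambda>k. (m, k)) ` {m<..<hi} \<union>
        block_graph lo m \<union> block_graph (m + 1) hi"
      using False by (subst block_graph.simps) (simp add: m_def Let_def)
    also have "card \<dots> \<le> card ((\<lambda>k. (k, m)) ` {lo..<m}) + card ((\<lambda>k. (m, k)) ` {m<..<hi}) +
        card (block_graph lo m) + card (block_graph (m + 1) hi)"
      by (intro order.trans[OF card_Un_le] add_mono order.refl)
    also have "card ((\<lambda>k. (k, m)) ` {lo..<m}) + card ((\<lambda>k. (m, k)) ` {m<..<hi}) = s - 1"
      using s by (simp add: card_image inj_on_def)
    finally have "real (card (block_graph lo hi)) \<le>
        real (s - 1) + real (card (block_graph lo m)) + real (card (block_graph (m + 1) hi))"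
      by linarith
    also have "\<dots> \<le> real (s - 1) + real (m - lo) * (log 2 (real s) - 1) +
        real (hi - (m + 1)) * (log 2 (real s) - 1)"
      using 1(1)[OF False m_def] 1(2)[OF False m_def] half[OF s(3)] half[OF s(4)] by linarith
    also have "\<dots> = real (s - 1) + real ((m - lo) + (hi - (m + 1))) * (log 2 (real s) - 1)"
      by (simp only: of_nat_add algebra_simps)
    \<comment> \<open>The \<open>s - 1\<close> new edges cancel exactly against the 1 saved in the
      logarithm for each of the \<open>s - 1\<close> remaining blocks.\<close>
    also have "\<dots> = real (s - 1) * log 2 (real s)"
      unfolding s(2) by (simp add: algebra_simps)
    also have "\<dots> \<le> real s * log 2 (real s)"
      using s(1) by (intro mult_right_mono) auto
    finally show ?thesis
      by (simp add: s_def)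
  qed
qed

text \<open>As long as the median misses \<open>{P..Q}\<close>, this interval lies entirely on one
  side of it and the recursion is followed there. The range that is reached still contains both
  \<open>P\<close> and \<open>Q\<close>.\<close>

lemma block_graph_separator:
  assumes "lo \<le> P" "P \<le> Q" "Q < hi"
  shows "\<exists>lo' hi'. lo \<le> lo' \<and> lo' \<le> P \<and> Q < hi' \<and> hi' \<le> hi \<and>
    P \<le> (lo' + hi') div 2 \<and> (lo' + hi') div 2 \<le> Q \<and> block_graph lo' hi' \<subseteq> block_graph lo hi"
  using assms
proof (induction lo hi rule: block_graph.induct)
  case (1 lo hi)
  define m where "m = (lo + hi) div 2"
  have nle: "\<not> hi \<le> lo"
    using 1 by simp
  consider "m < P" | "Q < m" | "P \<le> m" "m \<le> Q"
    by linarith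
  then show ?case
  proof cases
    case 1
    then obtain lo' hi' where "m + 1 \<le> lo'" "lo' \<le> P" "Q < hi'" "hi' \<le> hi"
      "P \<le> (lo' + hi') div 2" "(lo' + hi') div 2 \<le> Q" "block_graph lo' hi' \<subseteq> block_graph (m + 1) hi"
      using "1.IH"(2)[OF nle m_def] "1.prems" by auto
    moreover have "lo \<le> m" "block_graph (m + 1) hi \<subseteq> block_graph lo hi"
      using nle block_graph_upper[of lo hi] by (auto simp: m_def)
    ultimately show ?thesis
      by (intro exI[of _ lo'] exI[of _ hi']) auto
  next
    case 2
    then obtain lo' hi' where "lo \<le> lo'" "lo' \<le> P" "Q < hi'" "hi' \<le> m"
      "P \<le> (lo' + hi') div 2" "(lo' + hi') div 2 \<le> Q" "block_graph lo' hi' \<subseteq> block_graph lo m"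
      using "1.IH"(1)[OF nle m_def] "1.prems" by auto
    moreover have "m \<le> hi" "block_graph lo m \<subseteq> block_graph lo hi"
      using nle block_graph_lower[of lo hi] by (auto simp: m_def)
    ultimately show ?thesis
      by (intro exI[of _ lo'] exI[of _ hi']) auto
  next
    case 3
    then show ?thesis
      using "1.prems" by (intro exI[of _ lo] exI[of _ hi]) (auto simp: m_def)
  qed
qed

text \<open>
  The first median m to hit \<open>{P..Q}\<close> separates P from Q unless m is an endpoint.  In that case
  drop m; the next median hitting the rest is too far from the dropped end to be its new
  endpoint.  If it is the opposite endpoint, drop that as well: the remaining recursion
  range is then exactly \<open>{P + 1..Q - 1}\<close>, whose median is interior.
\<close>

lemma block_graph_two_hops:
  assumes "lo \<le> P" "P + 4 \<le> Q" "Q < hi"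
  shows "\<exists>A M D. A \<in> {P, P + 1} \<and> D \<in> {Q - 1, Q} \<and>
    (A, M) \<in> block_graph lo hi \<and> (M, D) \<in> block_graph lo hi"
proof -
  have final: ?thesis if sub: "block_graph (P + 1) Q \<subseteq> block_graph lo hi"
  proof -
    let ?m = "(P + 1 + Q) div 2"
    \<comment> \<open>\<open>P + 4 \<le> Q\<close> leaves at least three blocks in the range, so its
      median is neither \<open>P + 1\<close> nor \<open>Q - 1\<close>.\<close>
    have "(P + 1, ?m) \<in> block_graph (P + 1) Q" "(?m, Q - 1) \<in> block_graph (P + 1) Q"
      using assms(2) block_graph_left[of "P + 1" "P + 1" Q] block_graph_right[of "P + 1" Q "Q - 1"]
      by auto
    with sub show ?thesis
      by blast
  qed
  have strict: ?thesis
    if "lo' \<le> A" "A < m" "m < D" "D < hi'" "m = (lo' + hi') div 2" "A \<in> {P, P + 1}" "D \<in> {Q - 1, Q}"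
      "block_graph lo' hi' \<subseteq> block_graph lo hi" for A D m lo' hi'
    using that block_graph_left[of lo' A hi'] block_graph_right[of lo' hi' D] by blast
  obtain lo\<^sub>1 hi\<^sub>1 where 1: "lo\<^sub>1 \<le> P" "Q < hi\<^sub>1" "P \<le> (lo\<^sub>1 + hi\<^sub>1) div 2" "(lo\<^sub>1 + hi\<^sub>1) div 2 \<le> Q"
    "block_graph lo\<^sub>1 hi\<^sub>1 \<subseteq> block_graph lo hi"
    using block_graph_separator[of lo P Q hi] assms by auto
  define m\<^sub>1 where "m\<^sub>1 = (lo\<^sub>1 + hi\<^sub>1) div 2"
  consider "P < m\<^sub>1" "m\<^sub>1 < Q" | "m\<^sub>1 = P" | "m\<^sub>1 = Q"
    using 1 unfolding m\<^sub>1_def by linarith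
  then show ?thesis
  proof cases
    case 1
    then show ?thesis
      using strict[OF _ _ _ _ m\<^sub>1_def, of P Q] \<open>lo\<^sub>1 \<le> P\<close> \<open>Q < hi\<^sub>1\<close> \<open>block_graph lo\<^sub>1 hi\<^sub>1 \<subseteq> _\<close> by simp
  next
    case 2
    then have sub: "block_graph (P + 1) hi\<^sub>1 \<subseteq> block_graph lo hi"
      using block_graph_upper[of lo\<^sub>1 hi\<^sub>1] 1 unfolding m\<^sub>1_def[symmetric] by simp
    \<comment> \<open>The range already starts at the left end of the target interval, so descending
      cannot move that end. Only the right end is still unknown.\<close>
    obtain lo\<^sub>2 hi\<^sub>2 where 3: "P + 1 \<le> lo\<^sub>2" "lo\<^sub>2 \<le> P + 1" "Q < hi\<^sub>2"
      "(lo\<^sub>2 + hi\<^sub>2) div 2 \<le> Q" "block_graph lo\<^sub>2 hi\<^sub>2 \<subseteq> block_graph (P + 1) hi\<^sub>1"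
      using block_graph_separator[of "P + 1" "P + 1" Q hi\<^sub>1] assms 1 by auto
    then have lo2: "lo\<^sub>2 = P + 1"
      by simp
    define m\<^sub>2 where "m\<^sub>2 = (P + 1 + hi\<^sub>2) div 2"
    have "P + 1 < m\<^sub>2"
      using 3 assms unfolding m\<^sub>2_def by linarith
    show ?thesis
    proof (cases "m\<^sub>2 = Q")
      case True
      moreover have "P + 1 < hi\<^sub>2"
        using 3 assms by simp
      ultimately have "block_graph (P + 1) Q \<subseteq> block_graph lo hi"
        using block_graph_lower[of "P + 1" hi\<^sub>2] 3(5) sub unfolding m\<^sub>2_def lo2 by blast
      then show ?thesis
        by (rule final)
    next
      case False
      then have "m\<^sub>2 < Q"
        using 3 unfolding lo2 m\<^sub>2_def by simp
      then show ?thesis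
        using strict[OF _ _ _ _ m\<^sub>2_def, of "P + 1" Q] \<open>P + 1 < m\<^sub>2\<close> 3 sub unfolding lo2 by simp
    qed
  next
    case 3
    then have sub: "block_graph lo\<^sub>1 Q \<subseteq> block_graph lo hi"
      using block_graph_lower[of lo\<^sub>1 hi\<^sub>1] 1 unfolding m\<^sub>1_def[symmetric] by simp
    have PQ: "P \<le> Q - 1" "Q - 1 < Q"
      using assms by auto
    obtain lo\<^sub>2 hi\<^sub>2 where 4: "lo\<^sub>2 \<le> P" "Q - 1 < hi\<^sub>2" "hi\<^sub>2 \<le> Q"
      "P \<le> (lo\<^sub>2 + hi\<^sub>2) div 2" "block_graph lo\<^sub>2 hi\<^sub>2 \<subseteq> block_graph lo\<^sub>1 Q"
      using block_graph_separator[OF 1(1), of "Q - 1" Q] PQ by blast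
    then have hi2: "hi\<^sub>2 = Q"
      by simp
    define m\<^sub>2 where "m\<^sub>2 = (lo\<^sub>2 + Q) div 2"
    have "m\<^sub>2 < Q - 1"
      using 4 assms unfolding m\<^sub>2_def by linarith
    show ?thesis
    proof (cases "m\<^sub>2 = P")
      case True
      moreover have "lo\<^sub>2 < Q"
        using 4 assms by simp
      ultimately have "block_graph (P + 1) Q \<subseteq> block_graph lo hi"
        using block_graph_upper[of lo\<^sub>2 Q] 4(5) sub unfolding m\<^sub>2_def hi2 by blast
      then show ?thesis
        by (rule final)
    next
      case False
      then have "P < m\<^sub>2"
        using 4 unfolding hi2 m\<^sub>2_def by simp
      then show ?thesis
        using strict[OF _ _ _ _ m\<^sub>2_def, of P "Q - 1"] \<open>m\<^sub>2 < Q - 1\<close> 4 sub unfolding hi2 by simp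
    qed
  qed
qed

subsection \<open>Short paths in graphs with independent edges\<close>

text \<open>\<open>exp (- x) \<le> 1 / (1 + x)\<close>, and
  \<open>(1 + x) * (1 - x / 2) \<ge> 1\<close> because \<open>x\<^sup>2 \<le> x\<close> on the unit
  interval.\<close>

lemma exp_minus_le_half:
  fixes x y :: real
  assumes "0 \<le> x" "x \<le> 1" "x \<le> y"
  shows "exp (- y) \<le> 1 - x / 2"
proof -
  have "exp (- y) \<le> exp (- x)"
    using assms by simp
  also have "\<dots> \<le> 1 / (1 + x)"
    using exp_ge_add_one_self[of x] assms by (simp add: exp_minus field_simps)
  also have "\<dots> \<le> 1 - x / 2"
  proof -
    have "x * x \<le> x * 1"
      using assms by (intro mult_left_mono) auto
    then show ?thesis
      using assms by (simp add: divide_le_eq) (simp add: algebra_simps)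
  qed
  finally show ?thesis .
qed

lemma prob_random_set_two_mem:
  assumes "finite E" "e \<in> E" "e' \<in> E" "e \<noteq> e'" "0 \<le> p e" "p e \<le> 1" "0 \<le> p e'" "p e' \<le> 1"
  shows "measure_pmf.prob (random_set E p) {X. e \<in> X \<and> e' \<in> X} = p e * p e'"
  using prob_random_set_indep2[of E "{e}" "{e'}" p "\<lambda>Y. e \<in> Y" "\<lambda>Y. e' \<in> Y"] assms
  by (simp add: prob_random_set_mem)

text \<open>Different midpoints use disjoint pairs of edges, so their failures are independent, each
  with probability \<open>1 - q\<^sup>2\<close>.\<close>

lemma prob_no_two_hop_path:
  fixes i j :: nat
  assumes E: "finite E" "\<And>k. i < k \<Longrightarrow> k < j \<Longrightarrow> (i, k) \<in> E \<and> (k, j) \<in> E"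
    and p: "\<And>k. i < k \<Longrightarrow> k < j \<Longrightarrow> p (i, k) = q \<and> p (k, j) = q" "0 \<le> q" "q \<le> 1"
  shows "measure_pmf.prob (random_set E p) {X. \<forall>k\<in>{i<..<j}. \<not> ((i, k) \<in> X \<and> (k, j) \<in> X)} =
    (1 - q\<^sup>2) ^ (j - i - 1)"
proof -
  define K where "K k = {(i, k), (k, j)}" for k
  have "measure_pmf.prob (random_set E p)
        {X. \<forall>k\<in>{i<..<j}. \<not> ((i, k) \<in> X \<inter> K k \<and> (k, j) \<in> X \<inter> K k)} =
      (\<Prod>k\<in>{i<..<j}. measure_pmf.prob (random_set E p)
        {X. \<not> ((i, k) \<in> X \<inter> K k \<and> (k, j) \<in> X \<inter> K k)})"
    using E by (intro prob_random_set_indep) (auto simp: K_def disjoint_family_on_def)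
  also have "\<dots> = (\<Prod>k\<in>{i<..<j}. 1 - q\<^sup>2)"
  proof (rule prod.cong[OF refl])
    fix k assume k: "k \<in> {i<..<j}"
    have "measure_pmf.prob (random_set E p) {X. (i, k) \<in> X \<and> (k, j) \<in> X} = q\<^sup>2"
      using k assms by (subst prob_random_set_two_mem) (auto simp: power2_eq_square)
    then show "measure_pmf.prob (random_set E p)
        {X. \<not> ((i, k) \<in> X \<inter> K k \<and> (k, j) \<in> X \<inter> K k)} = 1 - q\<^sup>2"
      using measure_pmf.prob_compl[of "{X. (i, k) \<in> X \<and> (k, j) \<in> X}" "random_set E p"]
      by (simp add: K_def set_diff_eq)
  qed
  finally show ?thesis
    by (simp add: K_def)
qed

text \<open>All of \<open>K\<close> is missed with probability at most
  \<open>exp (- (q * card K))\<close>. Capping \<open>x\<close> at 1 allows this to be linearised to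
  \<open>1 - x / 2\<close>.\<close>

lemma prob_random_set_hit:
  fixes q x :: real
  assumes "finite E" "K \<subseteq> E" "\<And>e. e \<in> K \<Longrightarrow> q \<le> p e \<and> p e \<le> 1"
    and "0 \<le> q" "0 \<le> x" "x \<le> 1" "x \<le> q * card K"
  shows "x / 2 \<le> measure_pmf.prob (random_set E p) {X. \<exists>e\<in>K. e \<in> X}"
proof -
  have "measure_pmf.prob (random_set E p) {X. \<forall>e\<in>K. e \<notin> X} = (\<Prod>e\<in>K. 1 + (- p e))"
    using assms by (subst prob_random_set_avoid) force+
  also have "\<dots> \<le> exp (\<Sum>e\<in>K. - p e)"
    using assms by (intro prod_one_plus_le_exp) force
  also have "\<dots> \<le> exp (- (q * card K))"
    using assms sum_mono[of K "\<lambda>_. q" p] by (simp add: sum_negf mult.commute)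
  also have "\<dots> \<le> 1 - x / 2"
    using assms by (intro exp_minus_le_half)
  finally show ?thesis
    using measure_pmf.prob_compl[of "{X. \<forall>e\<in>K. e \<notin> X}" "random_set E p"]
    by (simp add: set_diff_eq)
qed

text \<open>The three error terms are: too few neighbours of \<open>i\<close> in \<open>A\<close>,
  too few neighbours of \<open>j\<close> in \<open>D\<close>, and failure of all middle vertices.
  Here \<open>x\<close> bounds from below the expected number of edges between a middle vertex and
  either neighbourhood once these are large.\<close>

lemma prob_no_four_hop_path:
  fixes i j :: nat and q r x :: real
  assumes fin: "finite E" "finite A" "finite M" "finite D"
    and ord: "\<And>a. a \<in> A \<Longrightarrow> i < a" "\<And>a m. a \<in> A \<Longrightarrow> m \<in> M \<Longrightarrow> a < m"
      "\<And>m d. m \<in> M \<Longrightarrow> d \<in> D \<Longrightarrow> m < d" "\<And>d. d \<in> D \<Longrightarrow> d < j"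
    and sub: "{i} \<times> A \<subseteq> E" "A \<times> M \<subseteq> E" "M \<times> D \<subseteq> E" "D \<times> {j} \<subseteq> E"
    and p: "\<And>e. e \<in> {i} \<times> A \<union> D \<times> {j} \<Longrightarrow> p e = r" "0 \<le> r" "r \<le> 1"
      "\<And>e. e \<in> A \<times> M \<union> M \<times> D \<Longrightarrow> q \<le> p e \<and> p e \<le> 1" "0 \<le> q"
    and x: "0 \<le> x" "x \<le> 1" "x \<le> q * (card A * r / 4)" "x \<le> q * (card D * r / 4)"
  shows "measure_pmf.prob (random_set E p)
      {X. \<not> (\<exists>a\<in>A. \<exists>m\<in>M. \<exists>d\<in>D. (i, a) \<in> X \<and> (a, m) \<in> X \<and> (m, d) \<in> X \<and> (d, j) \<in> X)} \<le>
    exp (- (card A * r / 4)) + exp (- (card D * r / 4)) + exp (- (card M * x\<^sup>2 / 4))"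
proof -
  define E\<^sub>1 where "E\<^sub>1 = {i} \<times> A \<union> D \<times> {j}"
  define E\<^sub>2 where "E\<^sub>2 = A \<times> M \<union> M \<times> D"
  define B where "B = {Y. card (Y \<inter> {i} \<times> A) \<le> card A * r / 4 \<or> card (Y \<inter> D \<times> {j}) \<le> card D * r / 4}"
  define R where "R Y Z \<longleftrightarrow> \<not> (\<exists>a\<in>A. \<exists>m\<in>M. \<exists>d\<in>D. (i, a) \<in> Y \<and> (a, m) \<in> Z \<and> (m, d) \<in> Z \<and> (d, j) \<in> Y)"
    for Y Z :: "(nat \<times> nat) set"
  have "measure_pmf.prob (random_set E p) {X. R (X \<inter> E\<^sub>1) (X \<inter> E\<^sub>2)} \<le>
      measure_pmf.prob (random_set E p) {X. X \<inter> E\<^sub>1 \<in> B} + exp (- (card M * x\<^sup>2 / 4))"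
  proof (rule prob_random_set_two_stage[OF fin(1)])
    show "E\<^sub>1 \<subseteq> E" "E\<^sub>2 \<subseteq> E"
      using sub by (auto simp: E\<^sub>1_def E\<^sub>2_def)
    have "i \<notin> A" "j \<notin> D" "i \<notin> M \<or> A = {}" "j \<notin> M \<or> D = {}" "m \<in> M \<Longrightarrow> m \<notin> D" for m
      using ord(1)[of i] ord(4)[of j] ord(3)[of m m] less_asym[OF ord(1) ord(2)[of _ i]]
        less_asym[OF ord(4) ord(3)[of j]] by auto
    then show "E\<^sub>1 \<inter> E\<^sub>2 = {}"
      unfolding E\<^sub>1_def E\<^sub>2_def by blast
  next
    fix Y assume Y: "Y \<subseteq> E\<^sub>1" "Y \<notin> B"
    define S where "S = {a \<in> A. (i, a) \<in> Y}"
    define T where "T = {d \<in> D. (d, j) \<in> Y}"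
    have S: "S \<subseteq> A" and T: "T \<subseteq> D"
      by (auto simp: S_def T_def)
    have "Y \<inter> {i} \<times> A = Pair i ` S" "Y \<inter> D \<times> {j} = (\<lambda>d. (d, j)) ` T"
      by (auto simp: S_def T_def)
    then have card: "card A * r / 4 \<le> card S" "card D * r / 4 \<le> card T"
      using Y(2) by (auto simp: B_def card_image inj_on_def)
    \<comment> \<open>Second-stage edges are grouped by their middle vertex. Since \<open>S\<close>
      lies before \<open>M\<close>, distinct groups share no edge, so failures at different
      \<open>m\<close> are independent.\<close>
    define K where "K m = S \<times> {m} \<union> {m} \<times> T" for m
    define U where "U m Z \<longleftrightarrow> (\<exists>e \<in> S \<times> {m}. e \<in> Z)" for m :: nat and Z :: "(nat \<times> nat) set"
    define V where "V m Z \<longleftrightarrow> (\<exists>e \<in> {m} \<times> T. e \<in> Z)" for m :: nat and Z :: "(nat \<times> nat) set"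
    have "measure_pmf.prob (random_set E p) {X. R Y (X \<inter> E\<^sub>2)} =
        measure_pmf.prob (random_set E p) {X. \<forall>m\<in>M. \<not> (U m (X \<inter> K m) \<and> V m (X \<inter> K m))}"
      by (rule arg_cong[where f = "measure_pmf.prob _"], rule Collect_cong)
        (auto simp: R_def U_def V_def S_def T_def K_def E\<^sub>2_def)
    also have "\<dots> = (\<Prod>m\<in>M. measure_pmf.prob (random_set E p) {X. \<not> (U m (X \<inter> K m) \<and> V m (X \<inter> K m))})"
    proof (rule prob_random_set_indep[OF fin(1,3)])
      show "K m \<subseteq> E" if "m \<in> M" for m
        using that sub S T by (auto simp: K_def)
      show "disjoint_family_on K M"
        unfolding disjoint_family_on_def
      proof (intro ballI impI)
        fix m m' assume "m \<in> M" "m' \<in> M" "m \<noteq> m'"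
        moreover have "m \<notin> S" "m' \<notin> S"
          using calculation S ord(2)[of m m] ord(2)[of m' m'] by auto
        ultimately show "K m \<inter> K m' = {}"
          by (auto simp: K_def)
      qed
    qed
    also have "\<dots> \<le> (\<Prod>m\<in>M. 1 + (- (x\<^sup>2 / 4)))"
    proof (rule prod_mono)
      fix m assume m: "m \<in> M"
      have "measure_pmf.prob (random_set E p) {X. U m (X \<inter> K m) \<and> V m (X \<inter> K m)} =
          measure_pmf.prob (random_set E p) {X. U m (X \<inter> S \<times> {m}) \<and> V m (X \<inter> {m} \<times> T)}"
        by (rule arg_cong[where f = "measure_pmf.prob _"], rule Collect_cong)
          (auto simp: U_def V_def K_def)
      also have "\<dots> = measure_pmf.prob (random_set E p) {X. U m (X \<inter> S \<times> {m})} *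
          measure_pmf.prob (random_set E p) {X. V m (X \<inter> {m} \<times> T)}"
      proof (rule prob_random_set_indep2[OF fin(1)])
        show "S \<times> {m} \<subseteq> E" "{m} \<times> T \<subseteq> E"
          using m sub S T by auto
        show "S \<times> {m} \<inter> {m} \<times> T = {}"
          using m S ord(2)[of m m] by auto
      qed
      \<comment> \<open>One factor \<open>x / 2\<close> for reaching \<open>m\<close> from
        \<open>S\<close>, one for reaching \<open>T\<close> from \<open>m\<close>.\<close>
      also have "\<dots> \<ge> (x / 2) * (x / 2)"
      proof (rule mult_mono)
        have "x / 2 \<le> measure_pmf.prob (random_set E p) {X. \<exists>e\<in>S \<times> {m}. e \<in> X}"
        proof (rule prob_random_set_hit[OF fin(1) _ _ p(5) x(1,2)])
          show "x \<le> q * card (S \<times> {m})"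
            using order.trans[OF x(3) mult_left_mono[OF card(1) p(5)]] by (simp add: card_cartesian_product)
          show "q \<le> p e \<and> p e \<le> 1" if "e \<in> S \<times> {m}" for e
            using that m S by (intro p(4)) auto
        qed (use m S sub in auto)
        then show "x / 2 \<le> measure_pmf.prob (random_set E p) {X. U m (X \<inter> S \<times> {m})}"
          by (simp add: U_def)
        have "x / 2 \<le> measure_pmf.prob (random_set E p) {X. \<exists>e\<in>{m} \<times> T. e \<in> X}"
        proof (rule prob_random_set_hit[OF fin(1) _ _ p(5) x(1,2)])
          show "x \<le> q * card ({m} \<times> T)"
            using order.trans[OF x(4) mult_left_mono[OF card(2) p(5)]] by (simp add: card_cartesian_product)
          show "q \<le> p e \<and> p e \<le> 1" if "e \<in> {m} \<times> T" for e
            using that m T by (intro p(4)) auto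
        qed (use m T sub in auto)
        then show "x / 2 \<le> measure_pmf.prob (random_set E p) {X. V m (X \<inter> {m} \<times> T)}"
          by (simp add: V_def)
      qed (use x in auto)
      finally show "0 \<le> measure_pmf.prob (random_set E p) {X. \<not> (U m (X \<inter> K m) \<and> V m (X \<inter> K m))} \<and>
          measure_pmf.prob (random_set E p) {X. \<not> (U m (X \<inter> K m) \<and> V m (X \<inter> K m))} \<le> 1 + (- (x\<^sup>2 / 4))"
        using measure_pmf.prob_compl[of "{X. U m (X \<inter> K m) \<and> V m (X \<inter> K m)}" "random_set E p"]
        by (simp add: set_diff_eq power2_eq_square)
    qed
    also have "\<dots> \<le> exp (\<Sum>m\<in>M. - (x\<^sup>2 / 4))"
    proof (rule prod_one_plus_le_exp)
      have "x\<^sup>2 \<le> 1"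
        using x(1,2) by (simp add: power_le_one)
      then show "- 1 \<le> - (x\<^sup>2 / 4)"
        by simp
    qed
    finally show "measure_pmf.prob (random_set E p) {X. R Y (X \<inter> E\<^sub>2)} \<le> exp (- (card M * x\<^sup>2 / 4))"
      by simp
  qed simp
  also have "measure_pmf.prob (random_set E p) {X. X \<inter> E\<^sub>1 \<in> B} \<le>
      measure_pmf.prob (random_set E p) ({X. card (X \<inter> {i} \<times> A) \<le> card ({i} \<times> A) * r / 4} \<union>
        {X. card (X \<inter> D \<times> {j}) \<le> card (D \<times> {j}) * r / 4})"
  proof (rule measure_pmf.finite_measure_mono)
    have "X \<inter> E\<^sub>1 \<inter> {i} \<times> A = X \<inter> {i} \<times> A" "X \<inter> E\<^sub>1 \<inter> D \<times> {j} = X \<inter> D \<times> {j}" for X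
      by (auto simp: E\<^sub>1_def)
    then show "{X. X \<inter> E\<^sub>1 \<in> B} \<subseteq> {X. card (X \<inter> {i} \<times> A) \<le> card ({i} \<times> A) * r / 4} \<union>
        {X. card (X \<inter> D \<times> {j}) \<le> card (D \<times> {j}) * r / 4}"
      by (auto simp: B_def card_cartesian_product)
  qed simp
  also have "\<dots> \<le> measure_pmf.prob (random_set E p) {X. card (X \<inter> {i} \<times> A) \<le> card ({i} \<times> A) * r / 4} +
      measure_pmf.prob (random_set E p) {X. card (X \<inter> D \<times> {j}) \<le> card (D \<times> {j}) * r / 4}"
    by (rule measure_Un_le) auto
  also have "\<dots> \<le> exp (- (card ({i} \<times> A) * r / 4)) + exp (- (card (D \<times> {j}) * r / 4))"
    using p(1-3) by (intro add_mono Chernoff_lower fin(1) sub(1,4)) auto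
  also have "{X. R (X \<inter> E\<^sub>1) (X \<inter> E\<^sub>2)} =
      {X. \<not> (\<exists>a\<in>A. \<exists>m\<in>M. \<exists>d\<in>D. (i, a) \<in> X \<and> (a, m) \<in> X \<and> (m, d) \<in> X \<and> (d, j) \<in> X)}"
    by (auto simp: R_def E\<^sub>1_def E\<^sub>2_def)
  finally show ?thesis
    by (simp add: card_cartesian_product)
qed

subsection \<open>The random spanner\<close>

lemma finite_local_edges: "finite (local_edges n L)"
  by (rule finite_subset[of _ "{1..n} \<times> {1..n}"]) (auto simp: local_edges_def)

text \<open>An edge is encoded by its left endpoint and its length.\<close>

lemma card_local_edges: "card (local_edges n L) \<le> n * L"
proof -
  have "local_edges n L \<subseteq> (\<lambda>(i, d). (i, i + d)) ` ({1..n} \<times> {1..L})"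
  proof
    fix e assume "e \<in> local_edges n L"
    then obtain i j where "e = (i, j)" "1 \<le> i" "i < j" "j \<le> n" "j - i \<le> L"
      by (auto simp: local_edges_def)
    then show "e \<in> (\<lambda>(i, d). (i, i + d)) ` ({1..n} \<times> {1..L})"
      by (intro image_eqI[of _ _ "(i, j - i)"]) auto
  qed
  then have "card (local_edges n L) \<le> card ({1..n} \<times> {1..L})"
    by (rule surj_card_le[rotated]) simp
  then show ?thesis
    by simp
qed

lemma block_disjoint:
  assumes "I \<noteq> J"
  shows "block n b I \<inter> block n b J = {}"
proof -
  have "block n b I \<inter> block n b J = {}" if "I < J" for I J
  proof -
    have "I * b \<le> (J - 1) * b"
      using that by (intro mult_right_mono) auto
    then show ?thesis
      unfolding block_def disjoint_iff by (metis IntE Suc_eq_plus1 atLeastAtMost_iff not_less_eq_eq order.trans)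
  qed
  from this[of I J] this[of J I] show ?thesis
    using assms by (cases I J rule: linorder_cases) auto
qed

lemma card_block_le: "card (block n b I) \<le> b"
proof -
  have "card (block n b I) \<le> card {(I - 1) * b + 1 .. I * b}"
    unfolding block_def by (intro card_mono) auto
  also have "\<dots> \<le> b"
    by (cases I) auto
  finally show ?thesis .
qed

lemma finite_block [simp]: "finite (block n b I)"
  by (simp add: block_def)

text \<open>All edges that some connector could contain: the ground set of the randomness in
  G.\<close>

definition connectors :: "nat \<Rightarrow> nat \<Rightarrow> graph" where
  "connectors n b = (\<Union>(I, J)\<in>block_graph 1 (num_blocks n b + 1). block n b I \<times> block n b J)"

lemma finite_connectors: "finite (connectors n b)"
  by (auto simp: connectors_def finite_block_graph)

text \<open>Blocks are pairwise disjoint, so different block pairs have disjoint sets of potential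
  edges and the connectors merge into one random set.\<close>

lemma random_G_eq_map:
  "random_G c n \<psi> = map_pmf (\<lambda>X. local_edges n (reach c n \<psi>) \<union> X)
    (random_set (connectors n (block_size c n \<psi>)) (\<lambda>_. tau c n \<psi>))"
proof -
  define b where "b = block_size c n \<psi>"
  define BG where "BG = block_graph 1 (num_blocks n b + 1)"
  define K where "K e = block n b (fst e) \<times> block n b (snd e)" for e
  have "disjoint_family_on K BG"
    unfolding disjoint_family_on_def
  proof (intro ballI impI)
    fix e e' :: "nat \<times> nat" assume "e \<noteq> e'"
    then consider "fst e \<noteq> fst e'" | "snd e \<noteq> snd e'"
      by (auto simp: prod_eq_iff)
    then show "K e \<inter> K e' = {}"
      by cases (auto simp: K_def Times_Int_Times dest!: block_disjoint[of _ _ n b])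
  qed
  then have "map_pmf (\<lambda>X. \<Union>e\<in>BG. X e) (Pi_pmf BG {} (\<lambda>e. random_set (K e) (\<lambda>_. tau c n \<psi>))) =
      random_set (\<Union>e\<in>BG. K e) (\<lambda>_. tau c n \<psi>)"
    by (intro random_set_UNION) (simp_all add: BG_def finite_block_graph K_def[abs_def])
  also have "(\<Union>e\<in>BG. K e) = connectors n b"
    by (simp add: connectors_def BG_def K_def case_prod_unfold)
  finally have *: "random_set (connectors n b) (\<lambda>_. tau c n \<psi>) =
      map_pmf (\<lambda>X. \<Union>e\<in>BG. X e) (Pi_pmf BG {} (\<lambda>e. random_set (K e) (\<lambda>_. tau c n \<psi>)))"
    by simp
  show ?thesis
    unfolding b_def[symmetric] * pmf.map_comp
    by (simp add: random_G_def Let_def BG_def b_def K_def random_subgraph_eq_random_set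
        case_prod_unfold o_def)
qed

text \<open>
  Connector edges of length at most L also belong to the local edges, hence are in G with
  certainty and get weight \<open>\<psi>\<close>.
\<close>

definition edge_weight :: "real \<Rightarrow> nat \<Rightarrow> real \<Rightarrow> nat \<times> nat \<Rightarrow> real" where
  "edge_weight c n \<psi> e = (if e \<in> local_edges n (reach c n \<psi>) then \<psi> else tau c n \<psi> * \<psi>)"

definition all_edges :: "real \<Rightarrow> nat \<Rightarrow> real \<Rightarrow> graph" where
  "all_edges c n \<psi> = local_edges n (reach c n \<psi>) \<union> connectors n (block_size c n \<psi>)"

lemma finite_all_edges: "finite (all_edges c n \<psi>)"
  by (simp add: all_edges_def finite_local_edges finite_connectors)

lemma tau_bounds: "0 < \<psi> \<Longrightarrow> 0 \<le> tau c n \<psi> \<and> tau c n \<psi> \<le> 1"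
  by (simp add: tau_def nabla_def)

text \<open>Giving local edges probability 1 makes G itself a random set on
  \<open>all_edges\<close>; thinning it by \<psi> multiplies the weights.\<close>

lemma random_H_eq:
  assumes "0 < \<psi>" "\<psi> < 1"
  shows "random_H c n \<psi> = random_set (all_edges c n \<psi>) (edge_weight c n \<psi>)"
proof -
  define Lo where "Lo = local_edges n (reach c n \<psi>)"
  define K where "K = connectors n (block_size c n \<psi>)"
  define t where "t = tau c n \<psi>"
  define p where "p e = (if e \<in> Lo then 1 else t)" for e
  have fin: "finite Lo" "finite K"
    by (auto simp: Lo_def K_def finite_local_edges finite_connectors)
  have "random_G c n \<psi> = map_pmf (\<lambda>X. Lo \<union> X) (random_set K (\<lambda>_. t))"
    by (simp add: random_G_eq_map Lo_def K_def t_def)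
  \<comment> \<open>Sampled connector edges in \<open>Lo\<close> are absorbed by the union with
    \<open>Lo\<close>. Dropping them makes the two ground sets disjoint.\<close>
  also have "\<dots> = map_pmf (\<lambda>X. Lo \<union> X) (map_pmf (\<lambda>X. X \<inter> (K - Lo)) (random_set K (\<lambda>_. t)))"
    unfolding pmf.map_comp
  proof (rule map_pmf_cong[OF refl])
    fix X assume "X \<in> set_pmf (random_set K (\<lambda>_. t))"
    then have "X \<subseteq> K"
      using set_pmf_random_set_subset[of K] by auto
    then show "Lo \<union> X = ((\<lambda>X. Lo \<union> X) \<circ> (\<lambda>X. X \<inter> (K - Lo))) X"
      by auto
  qed
  also have "map_pmf (\<lambda>X. X \<inter> (K - Lo)) (random_set K (\<lambda>_. t)) = random_set (K - Lo) (\<lambda>_. t)"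
    using fin by (intro random_set_Int) auto
  also have "\<dots> = random_set (K - Lo) p"
    by (intro random_set_cong) (auto simp: p_def)
  also have "map_pmf (\<lambda>X. Lo \<union> X) \<dots> = random_set (Lo \<union> (K - Lo)) p"
  proof -
    have "random_set Lo p = return_pmf Lo"
      using random_set_one[OF fin(1)] random_set_cong[of Lo Lo p "\<lambda>_. 1"] by (simp add: p_def)
    then show ?thesis
      using fin by (subst random_set_Un) (auto simp: pair_return_pmf1 pmf.map_comp o_def)
  qed
  also have "Lo \<union> (K - Lo) = all_edges c n \<psi>"
    by (auto simp: all_edges_def Lo_def K_def)
  finally have "random_H c n \<psi> =
      random_set (all_edges c n \<psi>) p \<bind> (\<lambda>G. random_set G (\<lambda>_. \<psi>))"
    by (simp add: random_H_def random_subgraph_eq_random_set)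
  also have "\<dots> = random_set (all_edges c n \<psi>) (\<lambda>e. p e * \<psi>)"
    using assms tau_bounds[of \<psi> c n]
    by (intro random_set_thin) (auto simp: finite_all_edges p_def t_def)
  also have "\<dots> = random_set (all_edges c n \<psi>) (edge_weight c n \<psi>)"
    by (rule random_set_cong) (auto simp: p_def Lo_def edge_weight_def t_def)
  finally show ?thesis .
qed

lemma has_straight_path_4I:
  assumes "i < a" "a < m" "m < d" "d < j" "(i, a) \<in> E" "(a, m) \<in> E" "(m, d) \<in> E" "(d, j) \<in> E"
  shows "has_straight_path E 4 i j"
  unfolding has_straight_path_def straight_path_def hops_def
  using assms by (intro exI[of _ "[i, a, m, d, j]"]) auto

lemma has_straight_path_2I:
  assumes "i < k" "k < j" "(i, k) \<in> E" "(k, j) \<in> E"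
  shows "has_straight_path E 4 i j"
  unfolding has_straight_path_def straight_path_def hops_def
  using assms by (intro exI[of _ "[i, k, j]"]) auto

locale spanner_params =
  fixes c \<psi> :: real and n :: nat
  assumes c: "c \<ge> 8" and psi: "0 < \<psi>" "\<psi> < 1" and n: "n \<ge> 2"
begin

text \<open>Equals \<open>nabla \<psi> / \<psi>\<close>, so that the block size is
  \<open>c * w * ln n\<close> rounded up.\<close>

definition w :: real where "w = 1 / \<psi> powr (4 / 3)"
definition b :: nat where "b = block_size c n \<psi>"

section \<open>Numerical estimates for the parameters\<close>

lemma nabla_div: "nabla \<psi> / \<psi> = w"
proof -
  have "\<psi> powr (4 / 3) = \<psi> powr (1 / 3 + 1)"
    by simp
  also have "\<dots> = \<psi> powr (1 / 3) * \<psi>"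
    using psi by (subst powr_add) simp
  finally show ?thesis
    by (simp add: nabla_def w_def)
qed

lemma w_psi2: "w * \<psi>\<^sup>2 = \<psi> powr (2 / 3)"
proof -
  have "\<psi>\<^sup>2 = \<psi> powr (2 / 3 + 4 / 3)"
    using psi by simp
  also have "\<dots> = \<psi> powr (2 / 3) * \<psi> powr (4 / 3)"
    by (rule powr_add)
  finally show ?thesis
    using psi by (simp add: w_def)
qed

lemma w_ge: "1 \<le> w" "1 \<le> w * \<psi>" "w * (\<psi> powr (2 / 3))\<^sup>2 = 1"
proof -
  have "\<psi> powr (4 / 3) \<le> \<psi> powr 1"
    using psi by (intro powr_mono') auto
  then show "1 \<le> w * \<psi>"
    using psi by (simp add: w_def)
  also have "w * \<psi> \<le> w * 1"
    using psi by (intro mult_left_mono) (auto simp: w_def)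
  finally show "1 \<le> w"
    by simp
  show "w * (\<psi> powr (2 / 3))\<^sup>2 = 1"
    using psi by (simp add: w_def power2_eq_square flip: powr_add)
qed

lemma ln_n: "1 / 2 \<le> ln (real n)"
proof -
  have "1 / 2 \<le> ln (2::real)"
    using ln2_ge_two_thirds by simp
  also have "\<dots> \<le> ln (real n)"
    using n by simp
  finally show ?thesis .
qed

lemma c_ln: "4 \<le> c * ln (real n)"
  using mult_mono[OF c ln_n] c by simp

lemma cw_ln: "c * ln (real n) \<le> c * w * ln (real n)"
  using w_ge c ln_n by (simp add: mult_le_cancel_right1)

lemma b_def': "b = nat \<lceil>c * w * ln (real n)\<rceil>"
  by (simp add: b_def block_size_def nabla_div flip: times_divide_eq_right)

lemma b_ge: "c * w * ln (real n) \<le> b" "1 \<le> b"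
proof -
  show *: "c * w * ln (real n) \<le> b"
    unfolding b_def' by linarith
  show "1 \<le> b"
    using * c_ln cw_ln by linarith
qed

text \<open>Rounding up adds less than 1, which is absorbed because \<open>c * w * ln n\<close> is
  at least 4.\<close>

lemma b_le: "b \<le> 2 * (c * w * ln (real n))"
  using c_ln cw_ln unfolding b_def' by linarith

lemma tau_eq: "tau c n \<psi> = min 1 (c\<^sup>2 * w / b)"
  unfolding tau_def b_def[symmetric] nabla_div[symmetric] by (simp add: mult.commute)

section \<open>Number of edges of G\<close>

lemma card_connectors: "card (connectors n b) \<le> 4 * real n * ln (real n) * b"
proof -
  define N where "N = num_blocks n b"
  define BG where "BG = block_graph 1 (N + 1)"
  have "card BG \<le> real N * log 2 (real N)"
    using card_block_graph[of 1 "N + 1"] by (simp add: BG_def)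
  also have "\<dots> \<le> 4 * real n * ln (real n) / b"
  proof (cases "N \<le> 1")
    case True
    then consider "N = 0" | "N = 1"
      by linarith
    then show ?thesis
      using ln_n by cases auto
  next
    case False
    then have nb: "real n / b > 1"
      unfolding N_def num_blocks_def by linarith
    \<comment> \<open>Rounding up a number above 1 at most doubles it. With a single block this
      could fail, but then the block graph has no edges.\<close>
    then have N_le: "real N \<le> 2 * (real n / b)"
      unfolding N_def num_blocks_def by linarith
    have "N \<le> n"
    proof -
      have "real n / b \<le> real n"
        using b_ge(2) by (simp add: divide_le_eq mult_le_cancel_left1)
      then show ?thesis
        unfolding N_def num_blocks_def by linarith
    qed
    then have "log 2 (real N) \<le> log 2 (real n)"
      using False by simp
    also have "\<dots> \<le> 2 * ln (real n)"
      using ln2_ge_two_thirds ln_n mult_left_mono[of "1/2" "ln 2" "ln (real n)"]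
      by (simp add: log_def divide_le_eq)
    finally have "real N * log 2 (real N) \<le> (2 * (real n / b)) * (2 * ln (real n))"
      using N_le False by (intro mult_mono) auto
    then show ?thesis
      by simp
  qed
  finally have BG: "card BG \<le> 4 * real n * ln (real n) / b" .
  have "card (connectors n b) \<le> (\<Sum>e\<in>BG. card (block n b (fst e) \<times> block n b (snd e)))"
    unfolding connectors_def BG_def N_def case_prod_unfold by (rule card_UN_le[OF finite_block_graph])
  also have "\<dots> \<le> (\<Sum>e\<in>BG. b * b)"
    by (intro sum_mono) (simp add: card_cartesian_product mult_le_mono card_block_le)
  finally have "real (card (connectors n b)) \<le> real (card BG * (b * b))"
    by (simp only: of_nat_le_iff sum_constant of_nat_id)
  also have "\<dots> = card BG * (real b * b)"
    by simp
  also have "\<dots> \<le> 4 * real n * ln (real n) / b * (real b * b)"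
    by (intro mult_right_mono BG) auto
  finally show ?thesis
    using b_ge(2) by simp
qed

text \<open>Only connector edges are random. In their mean the block size cancels against the one in
  \<open>tau\<close>. In the constant, \<open>12 * c\<close> pays for the local edges,
  \<open>8 * c\<^sup>2\<close> for twice the bound on the mean, and \<open>C\<close> is the slack
  that yields the failure probability.\<close>

lemma prob_few_edges:
  assumes "C > 0"
  shows "measure_pmf.prob (random_G c n \<psi>)
      {G. real (card G) \<le> (12 * c + 8 * c\<^sup>2 + C) * (real n / \<psi> powr (4 / 3) * ln (real n))}
    \<ge> 1 - 1 / real n powr C"
proof -
  define Z where "Z = real n / \<psi> powr (4 / 3) * ln (real n)"
  have Z: "Z = real n * w * ln (real n)"
    by (simp add: Z_def w_def)
  define Lo where "Lo = local_edges n (reach c n \<psi>)"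
  define K where "K = connectors n b"
  define k where "k = (8 * c\<^sup>2 + C) * Z"
  have "1 * 1 * ln (real n) \<le> Z"
    unfolding Z using n w_ge ln_n by (intro mult_mono) auto
  then have Z_ge: "ln (real n) \<le> Z"
    by simp
  have "card Lo \<le> real n * (6 * b)"
    using card_local_edges[of n "6 * b"] unfolding Lo_def reach_def b_def[symmetric]
    by (metis of_nat_le_iff of_nat_mult of_nat_numeral)
  also have "\<dots> \<le> real n * (6 * (2 * (c * w * ln (real n))))"
    using b_le by (intro mult_left_mono) auto
  also have "\<dots> = 12 * c * Z"
    by (simp add: Z)
  finally have Lo: "card Lo \<le> 12 * c * Z" .
  have "card K * tau c n \<psi> \<le> (4 * real n * ln (real n) * b) * (c\<^sup>2 * w / b)"
    using card_connectors tau_bounds[OF psi(1)] ln_n unfolding K_def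
    by (intro mult_mono) (auto simp: tau_eq w_def)
  also have "\<dots> = 4 * c\<^sup>2 * Z"
    using b_ge(2) by (simp add: Z)
  finally have mean: "card K * tau c n \<psi> \<le> 4 * c\<^sup>2 * Z" .
  have "measure_pmf.prob (random_G c n \<psi>) (- {G. real (card G) \<le> (12 * c + 8 * c\<^sup>2 + C) * Z}) =
      measure_pmf.prob (random_set K (\<lambda>_. tau c n \<psi>))
        {X. \<not> real (card (Lo \<union> X)) \<le> (12 * c + 8 * c\<^sup>2 + C) * Z}"
    by (simp add: random_G_eq_map Lo_def K_def b_def vimage_def Compl_eq)
  also have "\<dots> \<le> measure_pmf.prob (random_set K (\<lambda>_. tau c n \<psi>)) {X. k \<le> card X}"
  proof (rule measure_pmf.finite_measure_mono)
    have "k \<le> card X" if "\<not> real (card (Lo \<union> X)) \<le> (12 * c + 8 * c\<^sup>2 + C) * Z" for X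
    proof -
      have "real (card (Lo \<union> X)) \<le> card Lo + card X"
        using card_Un_le[of Lo X] by linarith
      then show ?thesis
        using that Lo by (simp add: k_def algebra_simps)
    qed
    then show "{X. \<not> real (card (Lo \<union> X)) \<le> (12 * c + 8 * c\<^sup>2 + C) * Z} \<subseteq> {X. k \<le> card X}"
      by auto
  qed simp
  also have "\<dots> \<le> exp (2 * (\<Sum>e\<in>K. tau c n \<psi>) - k)"
    using tau_bounds[OF psi(1)] by (intro Chernoff_upper) (auto simp: K_def finite_connectors)
  also have "\<dots> \<le> exp (- (C * ln (real n)))"
  proof -
    have "C * ln (real n) \<le> C * Z"
      using assms Z_ge by simp
    then show ?thesis
      using mean by (simp add: k_def algebra_simps)
  qed
  also have "\<dots> = 1 / real n powr C"
    using n by (simp add: powr_def exp_minus inverse_eq_divide)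
  finally show ?thesis
    using measure_pmf.prob_compl[of "{G. real (card G) \<le> (12 * c + 8 * c\<^sup>2 + C) * Z}" "random_G c n \<psi>"]
    unfolding Z_def by (simp add: Compl_eq_Diff_UNIV)
qed

section \<open>Coverage of near and far pairs\<close>

lemma edge_weight_bounds: "tau c n \<psi> * \<psi> \<le> edge_weight c n \<psi> e" "edge_weight c n \<psi> e \<le> 1"
  using tau_bounds[OF psi(1), of c n] psi mult_right_mono[of "tau c n \<psi>" 1 \<psi>]
    mult_le_one[of "tau c n \<psi>" \<psi>]
  by (auto simp: edge_weight_def)

lemma prob_uncovered_near:
  assumes "1 \<le> i" "i < j" "j \<le> n" "j - i \<le> 6 * b"
  shows "measure_pmf.prob (random_H c n \<psi>) {H. \<not> has_straight_path H 4 i j} \<le> (1 - \<psi>\<^sup>2) ^ (j - i - 1)"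
proof -
  have local: "(i, k) \<in> local_edges n (reach c n \<psi>)" "(k, j) \<in> local_edges n (reach c n \<psi>)"
    if "i < k" "k < j" for k
    using that assms by (auto simp: local_edges_def reach_def b_def)
  have "measure_pmf.prob (random_H c n \<psi>) {H. \<not> has_straight_path H 4 i j} \<le>
      measure_pmf.prob (random_H c n \<psi>) {H. \<forall>k\<in>{i<..<j}. \<not> ((i, k) \<in> H \<and> (k, j) \<in> H)}"
    by (intro measure_pmf.finite_measure_mono) (auto intro: has_straight_path_2I)
  also have "\<dots> = (1 - \<psi>\<^sup>2) ^ (j - i - 1)"
    unfolding random_H_eq[OF psi] using local psi
    by (intro prob_no_two_hop_path) (auto simp: finite_all_edges edge_weight_def, auto simp: all_edges_def)
  finally show ?thesis .
qed

lemma prob_uncovered_far: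
  assumes "1 \<le> i" "j \<le> n" "i + 6 * b < j"
  shows "measure_pmf.prob (random_H c n \<psi>) {H. \<not> has_straight_path H 4 i j} \<le> real n powr (2 - c / 4)"
proof -
  define I where "I = (i - 1) div b + 1"
  define J where "J = (j - 1) div b + 1"
  have b: "b > 0"
    using b_ge(2) by simp
  \<comment> \<open>A gap of more than \<open>6 * b\<close> puts \<open>J\<close> at least 6 beyond
    \<open>I\<close>, so \<open>I + 1\<close> and \<open>J - 1\<close> still differ by at least 4,
    as the two-hop lemma needs. Applying it to these inner indices keeps \<open>A\<close> and
    \<open>D\<close> strictly between \<open>I\<close> and \<open>J\<close>.\<close>
  have "((i - 1) + 6 * b) div b \<le> (j - 1) div b"
    using assms by (intro div_le_mono) auto
  then have IJ: "I + 6 \<le> J"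
    using b by (simp add: I_def J_def)
  have "real ((j - 1) div b) < real n / b"
  proof -
    have "(j - 1) div b * b \<le> j - 1"
      by simp
    then have "(j - 1) div b * b < n"
      using assms by linarith
    then have "real ((j - 1) div b) * b < n"
      by (metis of_nat_less_iff of_nat_mult)
    then show ?thesis
      using b by (simp add: less_divide_eq)
  qed
  then have JN: "J < num_blocks n b + 1"
    unfolding J_def num_blocks_def by linarith
  obtain A M D where AMD: "A \<in> {I + 1, I + 2}" "D \<in> {J - 2, J - 1}"
    "(A, M) \<in> block_graph 1 (num_blocks n b + 1)" "(M, D) \<in> block_graph 1 (num_blocks n b + 1)"
  proof -
    have "1 \<le> I + 1" "(I + 1) + 4 \<le> J - 1" "J - 1 < num_blocks n b + 1"
      "{I + 1, I + 1 + 1} = {I + 1, I + 2}" "{J - 1 - 1, J - 1} = {J - 2, J - 1}"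
      using IJ JN by auto
    then show ?thesis
      using that block_graph_two_hops[of 1 "I + 1" "J - 1" "num_blocks n b + 1"] by metis
  qed
  have AM: "A < M" and MD: "M < D"
    using AMD by (auto dest: block_graph_bounds)
  have i: "(I - 1) * b + 1 \<le> i" "i \<le> I * b"
  proof -
    have "(i - 1) div b * b < i" "i - 1 < b + (i - 1) div b * b"
      using b assms le_less_trans[OF div_times_less_eq_dividend[of "i - 1" b], of i]
      by (simp_all add: dividend_less_div_times)
    then show "(I - 1) * b + 1 \<le> i" "i \<le> I * b"
      using assms(1) by (auto simp: I_def)
  qed
  have j: "(J - 1) * b + 1 \<le> j" "j \<le> J * b"
  proof -
    have "(j - 1) div b * b < j" "j - 1 < b + (j - 1) div b * b"
      using b assms le_less_trans[OF div_times_less_eq_dividend[of "j - 1" b], of j]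
      by (simp_all add: dividend_less_div_times)
    then show "(J - 1) * b + 1 \<le> j" "j \<le> J * b"
      using assms by (auto simp: J_def)
  qed
  \<comment> \<open>Blocks up to \<open>D\<close> end before the block of \<open>j\<close> starts,
    hence before \<open>n\<close>, and are not cut off.\<close>
  have block: "block n b X = {(X - 1) * b + 1 .. X * b}" if "X \<le> D" for X
  proof -
    have "X * b \<le> (J - 1) * b"
      using that AMD(2) by (intro mult_right_mono) auto
    then have "X * b \<le> n"
      using j(1) assms(2) by linarith
    then show ?thesis
      by (auto simp: block_def)
  qed
  \<comment> \<open>\<open>1 \<le> X\<close> matters: under truncated subtraction block 0 is
    empty.\<close>
  have card_block: "card (block n b X) = b" if "1 \<le> X" "X \<le> D" for X
  proof -
    obtain Y where "X = Suc Y"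
      using \<open>1 \<le> X\<close> by (metis One_nat_def Suc_le_D)
    then show ?thesis
      using \<open>X \<le> D\<close> by (simp add: block)
  qed
  have next_block: "u < v" if "u \<in> block n b X" "v \<in> block n b Y" "X < Y" "Y \<le> D" for u v X Y
  proof -
    have "X * b \<le> (Y - 1) * b"
      using that by (intro mult_right_mono) auto
    moreover have "u \<le> X * b" "(Y - 1) * b + 1 \<le> v"
      using that by (auto simp: block)
    ultimately show ?thesis
      by linarith
  qed
  \<comment> \<open>\<open>A\<close> is at most two blocks after that of \<open>i\<close>, so
    \<open>a\<close> is less than \<open>3 * b\<close> away from \<open>i\<close>, well within the
    reach \<open>6 * b\<close>.\<close>
  have first: "i < a \<and> (i, a) \<in> local_edges n (reach c n \<psi>)" if "a \<in> block n b A" for a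
  proof -
    have "(A - 1) * b + 1 \<le> a" "a \<le> A * b"
      using that AM MD by (auto simp: block)
    moreover have "I \<le> A - 1" "A \<le> (I - 1) + 3"
      using AMD(1) by (auto simp: I_def)
    then have "I * b \<le> (A - 1) * b" "A * b \<le> (I - 1) * b + 3 * b"
      by (simp_all only: add_mult_distrib[symmetric] mult_le_mono1)
    ultimately have "i < a" "a - i \<le> 6 * b"
      using i by linarith+
    moreover have "a \<le> n"
      using that by (simp add: block_def)
    ultimately show ?thesis
      using assms(1) by (simp add: local_edges_def reach_def b_def)
  qed
  have last: "d < j \<and> (d, j) \<in> local_edges n (reach c n \<psi>)" if "d \<in> block n b D" for d
  proof -
    have "(D - 1) * b + 1 \<le> d" "d \<le> D * b"
      using that by (auto simp: block)
    moreover have "D \<le> J - 1" "J \<le> (D - 1) + 3"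
      using AMD(2) IJ by auto
    then have "D * b \<le> (J - 1) * b" "J * b \<le> (D - 1) * b + 3 * b"
      by (simp_all only: add_mult_distrib[symmetric] mult_le_mono1)
    ultimately have "d < j" "j - d \<le> 6 * b" "1 \<le> d"
      using j by linarith+
    then show ?thesis
      using assms(2) by (simp add: local_edges_def reach_def b_def)
  qed
  have conn: "block n b X \<times> block n b Y \<subseteq> all_edges c n \<psi>"
    if "(X, Y) \<in> block_graph 1 (num_blocks n b + 1)" for X Y
    using that unfolding all_edges_def connectors_def b_def by blast
  define x where "x = \<psi> powr (2 / 3)"
  define q where "q = tau c n \<psi> * \<psi>"
  have x: "0 \<le> x" "x \<le> 1"
    using psi by (auto simp: x_def powr_le1)
  have cb: "c * ln (real n) \<le> b * \<psi>" "c * ln (real n) \<le> b * x\<^sup>2"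
  proof -
    have "c * ln (real n) * 1 \<le> c * ln (real n) * (w * \<psi>)"
      using w_ge(2) c_ln by (intro mult_left_mono) auto
    also have "\<dots> = (c * w * ln (real n)) * \<psi>"
      by simp
    also have "\<dots> \<le> b * \<psi>"
      using b_ge(1) psi by (intro mult_right_mono) auto
    finally show "c * ln (real n) \<le> b * \<psi>"
      by simp
    have "c * ln (real n) = (c * w * ln (real n)) * x\<^sup>2"
      using w_ge(3) by (simp add: x_def)
    also have "\<dots> \<le> b * x\<^sup>2"
      using b_ge(1) by (intro mult_right_mono) auto
    finally show "c * ln (real n) \<le> b * x\<^sup>2" .
  qed
  \<comment> \<open>If \<open>tau\<close> is truncated, \<open>q = \<psi>\<close> and the size of
    \<open>b\<close> suffices through \<open>c * ln n \<ge> 4\<close>. Otherwise \<open>b\<close>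
    cancels, the right-hand side is \<open>c\<^sup>2 * x / 4\<close>, and \<open>c \<ge> 8\<close>
    suffices.\<close>
  have xq: "x \<le> q * (b * \<psi> / 4)"
  proof (cases "1 \<le> c\<^sup>2 * w / b")
    case True
    have "4 * x \<le> (c * ln (real n)) * (w * \<psi>\<^sup>2)"
      unfolding w_psi2 x_def using c_ln psi by (intro mult_right_mono) auto
    also have "\<dots> = (c * w * ln (real n)) * \<psi>\<^sup>2"
      by simp
    also have "\<dots> \<le> b * \<psi>\<^sup>2"
      using b_ge(1) by (intro mult_right_mono) auto
    finally show ?thesis
      using True by (simp add: q_def tau_eq power2_eq_square algebra_simps)
  next
    case False
    have "8\<^sup>2 \<le> c\<^sup>2"
      using c by (intro power_mono) auto
    then have "4 * x \<le> c\<^sup>2 * (w * \<psi>\<^sup>2)"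
      unfolding w_psi2 x_def using psi by (intro mult_right_mono) auto
    then show ?thesis
      using False b by (simp add: q_def tau_eq power2_eq_square algebra_simps)
  qed
  have card: "card (block n b A) = b" "card (block n b M) = b" "card (block n b D) = b"
    using AM MD AMD(1) by (auto intro!: card_block)
  have "measure_pmf.prob (random_H c n \<psi>) {H. \<not> has_straight_path H 4 i j} \<le>
      measure_pmf.prob (random_H c n \<psi>) {X. \<not> (\<exists>a\<in>block n b A. \<exists>m\<in>block n b M. \<exists>d\<in>block n b D.
        (i, a) \<in> X \<and> (a, m) \<in> X \<and> (m, d) \<in> X \<and> (d, j) \<in> X)}"
  proof (rule measure_pmf.finite_measure_mono)
    have "has_straight_path X 4 i j"
      if "a \<in> block n b A" "m \<in> block n b M" "d \<in> block n b D"
        "(i, a) \<in> X" "(a, m) \<in> X" "(m, d) \<in> X" "(d, j) \<in> X" for X a m d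
      using that first last AM MD by (intro has_straight_path_4I[of i a m d j]) (auto intro: next_block)
    then show "{H. \<not> has_straight_path H 4 i j} \<subseteq> {X. \<not> (\<exists>a\<in>block n b A. \<exists>m\<in>block n b M. \<exists>d\<in>block n b D.
        (i, a) \<in> X \<and> (a, m) \<in> X \<and> (m, d) \<in> X \<and> (d, j) \<in> X)}"
      by blast
  qed simp
  also have "\<dots> \<le> exp (- (card (block n b A) * \<psi> / 4)) + exp (- (card (block n b D) * \<psi> / 4)) +
      exp (- (card (block n b M) * x\<^sup>2 / 4))"
    unfolding random_H_eq[OF psi]
  proof (rule prob_no_four_hop_path[where q = q])
    show "{i} \<times> block n b A \<subseteq> all_edges c n \<psi>" "block n b D \<times> {j} \<subseteq> all_edges c n \<psi>"
      using first last by (auto simp: all_edges_def)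
    show "edge_weight c n \<psi> e = \<psi>" if "e \<in> {i} \<times> block n b A \<union> block n b D \<times> {j}" for e
      using that first last by (auto simp: edge_weight_def)
    show "x \<le> q * (card (block n b A) * \<psi> / 4)" "x \<le> q * (card (block n b D) * \<psi> / 4)"
      using xq by (simp_all add: card)
  qed (use x psi first last AM MD tau_bounds[OF psi(1)] conn[OF AMD(3)] conn[OF AMD(4)] in
      \<open>auto simp: finite_all_edges q_def edge_weight_bounds intro: next_block\<close>)
  also have "\<dots> \<le> exp (- (c / 4 * ln (real n))) + exp (- (c / 4 * ln (real n))) + exp (- (c / 4 * ln (real n)))"
    unfolding card using cb by (intro add_mono) auto
  also have "\<dots> = 3 * real n powr (- (c / 4))"
    using n by (simp add: powr_def)
  \<comment> \<open>The factor 3 is absorbed by \<open>n\<^sup>2 \<ge> 4\<close>.\<close>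
  also have "\<dots> \<le> real n powr 2 * real n powr (- (c / 4))"
  proof (rule mult_right_mono)
    have "2\<^sup>2 \<le> (real n)\<^sup>2"
      using n by (intro power_mono) auto
    then show "3 \<le> real n powr 2"
      using n by simp
  qed simp
  also have "\<dots> = real n powr (2 - c / 4)"
    by (subst powr_add[symmetric]) simp
  finally show ?thesis .
qed

text \<open>The threshold on \<open>c\<close> is what \<open>2 - c / 4 \<le> - 2 - C\<close>
  demands. The 2 in the new exponent pays for a union bound over at most \<open>n\<^sup>2\<close>
  pairs and leaves \<open>1 / n powr C\<close>.\<close>

lemma prob_uncovered_far':
  assumes "1 \<le> i" "j \<le> n" "i + 6 * b < j" "16 + 4 * C \<le> c"
  shows "measure_pmf.prob (random_H c n \<psi>) {H. \<not> has_straight_path H 4 i j} \<le> real n powr (- 2 - C)"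
proof -
  have "real n powr (2 - c / 4) \<le> real n powr (- 2 - C)"
    using assms(4) n by (intro powr_mono) auto
  then show ?thesis
    using prob_uncovered_far[OF assms(1-3)] by linarith
qed

lemma sum_geometric_le: "(\<Sum>j\<in>{i<..n}. (1 - \<psi>\<^sup>2) ^ (j - i - 1)) \<le> 1 / \<psi>\<^sup>2"
proof -
  define r where "r = 1 - \<psi>\<^sup>2"
  have "\<psi>\<^sup>2 < 1\<^sup>2"
    using psi by (intro power_strict_mono) auto
  then have r: "0 \<le> r"
    by (simp add: r_def)
  have "(\<Sum>j\<in>{i<..n}. r ^ (j - i - 1)) = (\<Sum>k<n - i. r ^ k)"
    by (rule sum.reindex_bij_witness[of _ "\<lambda>k. k + i + 1" "\<lambda>j. j - i - 1"]) auto
  moreover have "\<psi>\<^sup>2 * (\<Sum>k<n - i. r ^ k) = 1 - r ^ (n - i)"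
    using one_diff_power_eq[of r "n - i"] by (simp add: r_def)
  ultimately show ?thesis
    using psi zero_le_power[OF r, of "n - i"]
    by (simp add: r_def[symmetric] le_divide_eq mult.commute)
qed

text \<open>Linearity of expectation over pairs. Near pairs contribute a geometric sum per left
  endpoint; far pairs contribute at most \<open>n powr (- 2)\<close> each, hence at most 1 in
  total.\<close>

lemma expected_uncovered:
  assumes "16 + 4 * C \<le> c" "C > 0"
  shows "measure_pmf.expectation (random_H c n \<psi>) (\<lambda>H. real (card (uncovered_pairs n H 4)))
    \<le> real n / \<psi>\<^sup>2 + 1"
proof -
  define P where "P i j = measure_pmf.prob (random_H c n \<psi>) {H. \<not> has_straight_path H 4 i j}" for i j
  define Q where "Q = (SIGMA i:{1..n}. {i<..n})"
  have fin: "finite (set_pmf (random_H c n \<psi>))"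
    unfolding random_H_eq[OF psi] by (intro finite_set_pmf_random_set finite_all_edges)
  have card: "real (card (uncovered_pairs n H 4)) =
      (\<Sum>e\<in>Q. indicator {H. \<not> has_straight_path H 4 (fst e) (snd e)} H)" for H
  proof -
    have "uncovered_pairs n H 4 = {e \<in> Q. \<not> has_straight_path H 4 (fst e) (snd e)}"
      by (auto simp: uncovered_pairs_def Q_def)
    moreover have "finite Q"
      by (simp add: Q_def)
    ultimately show ?thesis
      by (simp add: indicator_def sum.If_cases Int_def)
  qed
  have "measure_pmf.expectation (random_H c n \<psi>) (\<lambda>H. real (card (uncovered_pairs n H 4))) =
      (\<Sum>e\<in>Q. measure_pmf.expectation (random_H c n \<psi>)
        (indicator {H. \<not> has_straight_path H 4 (fst e) (snd e)}))"
    unfolding card using fin by (intro Bochner_Integration.integral_sum integrable_measure_pmf_finite)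
  also have "\<dots> = (\<Sum>e\<in>Q. P (fst e) (snd e))"
    by (simp add: P_def)
  also have "\<dots> = (\<Sum>i=1..n. \<Sum>j\<in>{i<..n}. P i j)"
    unfolding Q_def by (subst sum.Sigma) (auto simp: case_prod_unfold)
  \<comment> \<open>Every pair is charged the sum of the near and the far bound, which avoids
    splitting the double sum by distance.\<close>
  also have "\<dots> \<le> (\<Sum>i=1..n. \<Sum>j\<in>{i<..n}. (1 - \<psi>\<^sup>2) ^ (j - i - 1) + real n powr (- 2))"
  proof (intro sum_mono)
    fix i j assume ij: "i \<in> {1..n}" "j \<in> {i<..n}"
    have "\<psi>\<^sup>2 \<le> 1\<^sup>2"
      using psi by (intro power_mono) auto
    then have pow: "0 \<le> (1 - \<psi>\<^sup>2) ^ (j - i - 1)"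
      by simp
    show "P i j \<le> (1 - \<psi>\<^sup>2) ^ (j - i - 1) + real n powr (- 2)"
    proof (cases "j - i \<le> 6 * b")
      case True
      then have "P i j \<le> (1 - \<psi>\<^sup>2) ^ (j - i - 1)"
        unfolding P_def using ij by (intro prob_uncovered_near) auto
      then show ?thesis
        by (simp add: add_increasing2)
    next
      case False
      then have "P i j \<le> real n powr (- 2 - C)"
        unfolding P_def using ij assms(1) by (intro prob_uncovered_far') auto
      also have "\<dots> \<le> real n powr (- 2)"
        using n assms(2) by (intro powr_mono) auto
      finally show ?thesis
        using pow by linarith
    qed
  qed
  also have "\<dots> \<le> (\<Sum>i=1..n. 1 / \<psi>\<^sup>2 + real n * real n powr (- 2))"
  proof (rule sum_mono)
    fix i
    have "(\<Sum>j\<in>{i<..n}. real n powr (- 2)) \<le> real n * real n powr (- 2)"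
      by (simp add: mult_right_mono)
    then show "(\<Sum>j\<in>{i<..n}. (1 - \<psi>\<^sup>2) ^ (j - i - 1) + real n powr (- 2)) \<le>
        1 / \<psi>\<^sup>2 + real n * real n powr (- 2)"
      unfolding sum.distrib using sum_geometric_le[of i] by linarith
  qed
  also have "\<dots> = real n / \<psi>\<^sup>2 + 1"
    using n by (simp add: powr_minus field_simps power2_eq_square)
  finally show ?thesis .
qed

lemma prob_all_far_covered:
  assumes "16 + 4 * C \<le> c"
  shows "measure_pmf.prob (random_H c n \<psi>) {H. \<forall>i\<in>{1..n}. \<forall>j\<in>{1..n}.
      real j > real i + 12 * c * (\<psi> powr (- 4 / 3) * ln (real n)) \<longrightarrow> has_straight_path H 4 i j}
    \<ge> 1 - 1 / real n powr C" (is "measure_pmf.prob _ ?good \<ge> _")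
proof -
  define F where "F = {(i, j) \<in> {1..n} \<times> {1..n}. i + 6 * b < j}"
  have "F \<subseteq> {1..n} \<times> {1..n}"
    by (auto simp: F_def)
  then have F: "finite F" "card F \<le> n * n"
    using card_mono[of "{1..n} \<times> {1..n}" F] by (auto dest: finite_subset)
  have "\<psi> powr (- 4 / 3) = w"
    by (simp add: w_def powr_minus_divide)
  \<comment> \<open>The constant \<open>12 * c\<close> is 6 times the factor \<open>2 * c\<close> in
    the upper bound on \<open>b\<close>.\<close>
  then have far: "i + 6 * b < j" if "real j > real i + 12 * c * (\<psi> powr (- 4 / 3) * ln (real n))" for i j
    using that b_le by (simp add: algebra_simps)
  have "measure_pmf.prob (random_H c n \<psi>) (- ?good) \<le>
      measure_pmf.prob (random_H c n \<psi>) (\<Union>e\<in>F. {H. \<not> has_straight_path H 4 (fst e) (snd e)})"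
    using far by (intro measure_pmf.finite_measure_mono) (auto simp: F_def)
  also have "\<dots> \<le> (\<Sum>e\<in>F. measure_pmf.prob (random_H c n \<psi>) {H. \<not> has_straight_path H 4 (fst e) (snd e)})"
    using F(1) by (intro measure_UNION_le) auto
  also have "\<dots> \<le> (\<Sum>e\<in>F. real n powr (- 2 - C))"
    using assms by (intro sum_mono prob_uncovered_far') (auto simp: F_def)
  also have "\<dots> \<le> real (n * n) * real n powr (- 2 - C)"
    using F(2) by (simp only: sum_constant) (intro mult_right_mono, auto simp only: of_nat_le_iff powr_ge_zero)
  also have "real (n * n) = real n powr 2"
    using n by (simp add: power2_eq_square)
  also have "real n powr 2 * real n powr (- 2 - C) = 1 / real n powr C"
    by (subst powr_add[symmetric]) (simp add: powr_minus_divide)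
  finally show ?thesis
    using measure_pmf.prob_compl[of ?good "random_H c n \<psi>"] by (simp add: Compl_eq_Diff_UNIV)
qed

end

theorem lemma5p12:
  fixes C :: real
  assumes "C > 0"
  shows "\<exists>c0>0. \<forall>c\<ge>c0. \<exists>K1>0. \<exists>K2>0. \<forall>(n::nat)>0. \<forall>\<psi>::real. 0 < \<psi> \<and> \<psi> < 1 \<longrightarrow>
    measure_pmf.prob (random_G c n \<psi>)
      {G. real (card G) \<le> K1 * (real n / \<psi> powr (4 / 3) * ln (real n))}
      \<ge> 1 - 1 / real n powr C \<and>
    measure_pmf.expectation (random_H c n \<psi>) (\<lambda>H. real (card (uncovered_pairs n H 4)))
      \<le> real n / \<psi>\<^sup>2 + 1 \<and>
    measure_pmf.prob (random_H c n \<psi>)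
      {H. \<forall>i\<in>{1..n}. \<forall>j\<in>{1..n}.
            real j > real i + K2 * (\<psi> powr (- 4 / 3) * ln (real n)) \<longrightarrow> has_straight_path H 4 i j}
      \<ge> 1 - 1 / real n powr C"
proof (rule exI[of _ "16 + 4 * C"], intro conjI allI impI)
  fix c :: real assume c0: "16 + 4 * C \<le> c"
  show "\<exists>K1>0. \<exists>K2>0. \<forall>(n::nat)>0. \<forall>\<psi>::real. 0 < \<psi> \<and> \<psi> < 1 \<longrightarrow>
    measure_pmf.prob (random_G c n \<psi>)
      {G. real (card G) \<le> K1 * (real n / \<psi> powr (4 / 3) * ln (real n))}
      \<ge> 1 - 1 / real n powr C \<and>
    measure_pmf.expectation (random_H c n \<psi>) (\<lambda>H. real (card (uncovered_pairs n H 4)))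
      \<le> real n / \<psi>\<^sup>2 + 1 \<and>
    measure_pmf.prob (random_H c n \<psi>)
      {H. \<forall>i\<in>{1..n}. \<forall>j\<in>{1..n}.
            real j > real i + K2 * (\<psi> powr (- 4 / 3) * ln (real n)) \<longrightarrow> has_straight_path H 4 i j}
      \<ge> 1 - 1 / real n powr C"
  proof (rule exI[of _ "12 * c + 8 * c\<^sup>2 + C"], rule conjI, goal_cases)
    case 2
    show ?case
    proof (rule exI[of _ "12 * c"], rule conjI, goal_cases)
      case 2
      show ?case
      proof (intro allI impI, goal_cases)
        case (1 n \<psi>)
        show ?case
        \<comment> \<open>For \<open>n = 1\<close> there are no pairs, and both probability bounds
          are trivial because \<open>1 / 1 powr C = 1\<close>. All other cases have
          \<open>n \<ge> 2\<close>, as the locale requires.\<close>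
        proof (cases "n = 1")
          case True
          then have "uncovered_pairs n H 4 = {}" for H
            by (auto simp: uncovered_pairs_def)
          then show ?thesis
            using True by simp
        next
          case False
          then interpret spanner_params c \<psi> n
            using 1 c0 assms by unfold_locales auto
          show ?thesis
            using prob_few_edges[OF assms] expected_uncovered[OF c0 assms] prob_all_far_covered[OF c0]
            by blast
        qed
      qed
    qed (use c0 assms in simp)
  qed (use c0 assms in \<open>auto intro!: add_pos_pos\<close>)
qed (use assms in simp)

end
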